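(* For every integer $N\ge1$, as $x\to0^+$, \[ \Phi(x)=\frac{C_0+\log16\pi^2x}{8\sqrt{\pi x}}+\frac{1}{8\sqrt{\pi}}\sum_{n=1}^N\frac{2^{2n}B_n(3/4)}{n!}\Gamma(n/2)\,x^{\frac{n-1}{2}}+O\bigl(x^{\frac{N}{2}}\bigr). \]
   Context: For $x>0$, $\Phi(x):=\frac{1}{2\pi}\int_0^{+\infty}e^{-xt^2}\Psi(t)\,dt$ with $\Psi(t):=\log 2\pi+\frac{\pi}{2\cosh\pi t}-\Re\{\Gamma'(\frac12+it)/\Gamma(\frac12+it)\}$; equivalently $\Phi(x)=\frac{C_0+\log 16\pi^2x}{8\sqrt{\pi x}}-\frac{1}{4\sqrt{\pi x}}\int_0^{+\infty}e^{-\frac{u^2}{16x}}\bigl(\frac{1}{u}-\frac{e^{\frac34 u}}{e^u-1}\bigr)\,du$. $C_0$ is Euler's constant, and $B_n(y)$ are the Bernoulli polynomials, defined by $\frac{ue^{yu}}{e^u-1}=\sum_{n\ge0}B_n(y)\frac{u^n}{n!}$. *)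

theory Defs
  imports
    "HOL-Analysis.Analysis"
    "HOL-Library.Landau_Symbols"
    "HOL-Computational_Algebra.Formal_Power_Series"
begin

definition Psi :: "real \<Rightarrow> real" where
  "Psi t = ln (2 * pi) + pi / (2 * cosh (pi * t))
     - Re (deriv Gamma (1/2 + \<i> * complex_of_real t) / Gamma (1/2 + \<i> * complex_of_real t))"

definition Phi :: "real \<Rightarrow> real" where
  "Phi x = 1 / (2 * pi) * (LBINT t:{0..}. exp (- x * t\<^sup>2) * Psi t)"

text \<open>
  The value at \<open>y\<close> of the \<open>n\<close>-th Bernoulli polynomial, read off from the generating function
  \<open>u e\<^bsup>yu\<^esup> / (e\<^sup>u - 1)\<close>. Numerator and denominator both have
  subdegree 1, so the division of formal power series cancels a factor \<open>u\<close>.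
\<close>
definition bernoulli_poly :: "nat \<Rightarrow> real \<Rightarrow> real" where
  "bernoulli_poly n y = fact n * fps_nth (fps_X * fps_exp y / (fps_exp 1 - 1)) n"

lemma bernoulli_poly_generating_function:
  "Abs_fps (\<lambda>n. bernoulli_poly n y / fact n) * (fps_exp 1 - 1) = fps_X * fps_exp y"
proof -
  have nth1: "fps_nth (fps_exp 1 - 1 :: real fps) 1 \<noteq> 0"
    by simp
  then have nz: "fps_exp 1 - 1 \<noteq> (0 :: real fps)"
    by (metis fps_zero_nth)
  have "subdegree (fps_exp 1 - 1 :: real fps) = 1"
    by (rule subdegreeI) (use nth1 in auto)
  moreover have "subdegree (fps_X * fps_exp y :: real fps) = 1"
    by (rule subdegreeI) auto
  ultimately have "(fps_exp 1 - 1 :: real fps) dvd fps_X * fps_exp y"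
    using nz by (subst fps_dvd_iff) auto
  moreover have "Abs_fps (\<lambda>n. bernoulli_poly n y / fact n) = fps_X * fps_exp y / (fps_exp 1 - 1)"
    by (simp add: bernoulli_poly_def fps_eq_iff)
  ultimately show ?thesis
    by simp
qed

end

theory Submission
  imports Defs "HOL-Probability.Probability"
begin

text \<open>
  By the duplication and reflection formulas, \<open>\<Psi>(t) = log \<pi> - Re \<psi>(1/4 + it/2)\<close>. Each term
  \<open>b / (b\<^sup>2 + (t/2)\<^sup>2)\<close> of the series for \<open>Re \<psi>\<close> is the Laplace transform of a cosine, whose
  integral against \<open>e\<^bsup>-xt\<^sup>2\<^esup>\<close> is again a Gaussian. Summing the resulting geometric series under
  the integral gives
  \<open>\<Phi>(x) = (C\<^sub>0 + log 16\<pi>\<^sup>2x) / (8 \<surd>(\<pi>x)) - 1 / (4 \<surd>(\<pi>x)) \<integral> e\<^bsup>-u\<^sup>2/16x\<^esup> (1/u - e\<^bsup>3u/4\<^esup>/(e\<^sup>u-1)) du\<close>,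
  where the constants come from two Frullani-type integrals, evaluated as limits of Mellin
  transforms at \<open>s = 0\<close>. Finally, the bracket differs from the \<open>N\<close>-th partial sum of
  \<open>-\<Sum> B\<^sub>n(3/4) u\<^bsup>n-1\<^esup>/n!\<close> by at most \<open>C u\<^sup>N\<close> on the whole half-line, and the Gaussian moments are
  Gamma values.
\<close>

subsection \<open>Mellin and Frullani integrals on the half-line\<close>

text \<open>Leaving out 0 keeps \<open>1 / u\<close> and \<open>u powr (s - 1)\<close> free of
  default values. A restricted measure, rather than set integrals, lets Fubini on a product and the
  \<open>has_bochner_integral\<close> rules apply directly.\<close>

abbreviation half_line :: "real measure" where
  "half_line \<equiv> restrict_space lborel {0<..}"

lemma measurable_half_line [measurable (raw)]:
  "f \<in> borel_measurable borel \<Longrightarrow> f \<in> borel_measurable half_line"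
  by (simp add: measurable_restrict_space1)

lemma integrable_half_line_bound:
  fixes f g :: "real \<Rightarrow> real"
  assumes "integrable half_line g" "f \<in> borel_measurable borel"
    and "\<And>u. u > 0 \<Longrightarrow> \<bar>f u\<bar> \<le> g u"
  shows "integrable half_line f"
proof (rule Bochner_Integration.integrable_bound[OF assms(1)])
  show "AE u in half_line. norm (f u) \<le> norm (g u)"
    using assms(3) by (intro AE_I2) (force simp: space_restrict_space)
qed (use assms in measurable)

lemma integral_half_line_cong:
  fixes f g :: "real \<Rightarrow> real"
  assumes "\<And>u. u > 0 \<Longrightarrow> f u = g u"
  shows "integral\<^sup>L half_line f = integral\<^sup>L half_line g"
  by (rule Bochner_Integration.integral_cong) (use assms in \<open>auto simp: space_restrict_space\<close>)

lemma integrable_half_line_cong: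
  fixes f g :: "real \<Rightarrow> real"
  assumes "\<And>u. u > 0 \<Longrightarrow> f u = g u"
  shows "integrable half_line f = integrable half_line g"
  by (rule Bochner_Integration.integrable_cong) (use assms in \<open>auto simp: space_restrict_space\<close>)

lemma half_line_dominated_convergence:
  fixes f w :: "real \<Rightarrow> real" and s :: "nat \<Rightarrow> real \<Rightarrow> real"
  assumes "f \<in> borel_measurable borel" "\<And>i. s i \<in> borel_measurable borel" "integrable half_line w"
    and "\<And>u. u > 0 \<Longrightarrow> (\<lambda>i. s i u) \<longlonglongrightarrow> f u"
    and "\<And>i u. u > 0 \<Longrightarrow> \<bar>s i u\<bar> \<le> w u"
  shows "(\<lambda>i. integral\<^sup>L half_line (s i)) \<longlonglongrightarrow> integral\<^sup>L half_line f"
proof (rule integral_dominated_convergence)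
  show "AE u in half_line. (\<lambda>i. s i u) \<longlonglongrightarrow> f u"
    using assms(4) by (intro AE_I2) (simp add: space_restrict_space)
  show "AE u in half_line. norm (s i u) \<le> w u" for i
    using assms(5) by (intro AE_I2) (simp add: space_restrict_space)
qed (use assms in measurable)

text \<open>Substitute \<open>v = c * u ^ p\<close> in Euler's integral for
  \<open>Gamma (s / p)\<close>. The case \<open>p = 1\<close> covers exponentials and
  \<open>p = 2\<close> the Gaussian moments; small \<open>s\<close> leads to the Frullani
  integrals.\<close>

lemma has_bochner_integral_powr_exp_power:
  fixes s c :: real and p :: nat
  assumes "s > 0" "c > 0" "p > 0"
  shows "has_bochner_integral half_line (\<lambda>u. u powr (s - 1) * exp (- c * u ^ p))
           (c powr (- (s / p)) * Gamma (s / p) / p)"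
proof -
  define f where "f v = v powr (s / p - 1) / exp v" for v :: real
  define g where "g u = c * u ^ p" for u :: real
  \<comment> \<open>The Jacobian times \<open>f (g u)\<close> equals
    \<open>c powr (s / p) * p\<close> times the wanted integrand; \<open>b\<close> is the reciprocal
    of that constant.\<close>
  define b where "b = c powr (- (s / p)) / p"
  have img: "g ` {0<..} = {0<..}"
  proof (intro equalityI subsetI)
    fix v :: real assume "v \<in> {0<..}"
    then have "v = g (root p (v / c))" "root p (v / c) \<in> {0<..}"
      using assms by (auto simp: g_def)
    then show "v \<in> g ` {0<..}" by blast
  qed (use assms in \<open>auto simp: g_def\<close>)
  have hasint: "(f has_integral Gamma (s / p)) {0<..}"
    using Gamma_integral_real[of "s / p"] assms
    by (subst has_integral_spike_set_eq[where T = "{0..}"])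
       (auto simp: f_def[abs_def] intro: empty_imp_negligible negligible_subset[OF negligible_sing[of 0]])
  have abs: "f absolutely_integrable_on {0<..}"
    using hasint by (intro nonnegative_absolutely_integrable_1) (auto simp: f_def)
  have "(\<lambda>u. \<bar>c * (p * u ^ (p - 1))\<bar> * f (g u)) absolutely_integrable_on {0<..} \<and>
        integral {0<..} (\<lambda>u. \<bar>c * (p * u ^ (p - 1))\<bar> * f (g u)) = Gamma (s / p)"
  proof (rule has_absolute_integral_change_of_variables_1'
      [where g = g and g' = "\<lambda>u. c * (p * u ^ (p - 1))", THEN iffD2])
    show "(g has_field_derivative c * (p * u ^ (p - 1))) (at u within {0<..})" if "u \<in> {0<..}" for u :: real
      unfolding g_def by (auto intro!: derivative_eq_intros)
    show "inj_on g {0<..}"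
      using assms by (auto simp: inj_on_def g_def power_eq_iff_eq_base)
    show "f absolutely_integrable_on g ` {0<..} \<and> integral (g ` {0<..}) f = Gamma (s / p)"
      using hasint abs by (auto simp: img)
  qed auto
  then have *: "(\<lambda>u. \<bar>c * (p * u ^ (p - 1))\<bar> * f (g u)) absolutely_integrable_on {0<..}"
    "integral {0<..} (\<lambda>u. \<bar>c * (p * u ^ (p - 1))\<bar> * f (g u)) = Gamma (s / p)"
    by auto
  \<comment> \<open>The change of variables is a statement about the completed measure
    \<open>lebesgue\<close>; Borel measurability of \<open>F\<close> brings it back to
    \<open>lborel\<close>.\<close>
  define F where "F u = indicator {0<..} u *\<^sub>R (\<bar>c * (p * u ^ (p - 1))\<bar> * f (g u))" for u :: real
  have meas: "F \<in> borel_measurable borel"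
    unfolding F_def f_def g_def by measurable
  have "integrable lebesgue F"
    using *(1) by (simp add: set_integrable_def F_def[abs_def])
  moreover have "integral\<^sup>L lebesgue F = Gamma (s / p)"
    using set_lebesgue_integral_eq_integral(2)[OF *(1)] *(2)
    by (simp add: set_lebesgue_integral_def F_def[abs_def])
  ultimately have "has_bochner_integral lborel F (Gamma (s / p))"
    using meas by (simp add: has_bochner_integral_iff integrable_completion integral_completion)
  then have "has_bochner_integral half_line (\<lambda>u. \<bar>c * (p * u ^ (p - 1))\<bar> * f (g u)) (Gamma (s / p))"
    by (subst has_bochner_integral_restrict_space) (auto simp: F_def[abs_def])
  then have "has_bochner_integral half_line (\<lambda>u. b * (\<bar>c * (p * u ^ (p - 1))\<bar> * f (g u))) (b * Gamma (s / p))"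
    by (intro has_bochner_integral_mult_right)
  also have "?this \<longleftrightarrow> ?thesis"
  proof (rule has_bochner_integral_cong)
    fix u assume "u \<in> space half_line"
    then have u: "u > 0" by (simp add: space_restrict_space)
    have c1: "c powr (- (s / p)) * c * c powr (s / p - 1) = 1"
    proof -
      have "c powr (- (s / p)) * c powr 1 * c powr (s / p - 1) = c powr 0"
        by (simp only: powr_add[symmetric]) simp
      then show ?thesis using assms by simp
    qed
    have u1: "u powr (real p - 1) * u powr (s - p) = u powr (s - 1)"
      by (simp add: powr_add[symmetric])
    have pow: "u ^ (p - 1) = u powr (real p - 1)"
      using u assms by (simp add: powr_realpow[symmetric] of_nat_diff)
    have "(c * u ^ p) powr (s / p - 1) = c powr (s / p - 1) * u powr (s - p)"
      using u assms by (simp add: powr_mult powr_realpow[symmetric] powr_powr algebra_simps)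
    then have "b * (\<bar>c * (p * u ^ (p - 1))\<bar> * f (g u)) =
        (c powr (- (s / p)) * c * c powr (s / p - 1)) * (u powr (real p - 1) * u powr (s - p)) * exp (- c * u ^ p)"
      using u assms unfolding pow
      by (simp add: b_def f_def g_def exp_minus abs_mult divide_inverse)
    then show "b * (\<bar>c * (p * u ^ (p - 1))\<bar> * f (g u)) = u powr (s - 1) * exp (- c * u ^ p)"
      by (simp only: c1 u1 mult_1_left)
  qed (auto simp: b_def)
  finally show ?thesis .
qed

lemma has_bochner_integral_exp_neg:
  fixes c :: real
  assumes "c > 0"
  shows "has_bochner_integral half_line (\<lambda>u. exp (- c * u)) (1 / c)"
proof -
  have "has_bochner_integral half_line (\<lambda>u. exp (- c * u)) (1 / c) \<longleftrightarrow>
        has_bochner_integral half_line (\<lambda>u. u powr (1 - 1) * exp (- c * u ^ 1)) 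
        (c powr (- (1 / real 1)) * Gamma (1 / real 1) / real 1)"
    using assms by (intro has_bochner_integral_cong) (auto simp: space_restrict_space powr_minus field_simps)
  with has_bochner_integral_powr_exp_power[of 1 c 1] assms show ?thesis by simp
qed

lemma integrable_exp_power:
  fixes c :: real and p :: nat
  assumes "c > 0" "p > 0"
  shows "integrable half_line (\<lambda>u. exp (- c * u ^ p))"
proof -
  have "integrable half_line (\<lambda>u. u powr (1 - 1) * exp (- c * u ^ p))"
    using has_bochner_integral_powr_exp_power[of 1 c p] assms 
    by (auto simp: has_bochner_integral_iff)
  then show ?thesis
    by (subst (asm) integrable_half_line_cong[where g = "\<lambda>u. exp (- c * u ^ p)"]) auto
qed

text \<open>Both exponentials are 1 + O(u) at 0, so the quotient stays bounded there even for
  different powers \<open>p\<close> and \<open>q\<close>; beyond 1 the division by \<open>u\<close>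
  only helps.\<close>

lemma integrable_exp_power_frullani:
  fixes c d :: real and p q :: nat
  assumes "c > 0" "p > 0" "d > 0" "q > 0"
  shows "integrable half_line (\<lambda>u. (exp (- c * u ^ p) - exp (- d * u ^ q)) / u)"
proof (rule integrable_half_line_bound)
  \<comment> \<open>Since \<open>exp 1 * exp (- u)\<close> is at least 1 on (0,1], the first summand
    is an integrable substitute for the constant bound \<open>c + d\<close> near 0.\<close>
  show "integrable half_line (\<lambda>u. (c + d) * exp 1 * exp (- 1 * u ^ 1) 
          + (exp (- c * u ^ p) + exp (- d * u ^ q)))"
    using assms by (intro Bochner_Integration.integrable_add integrable_mult_right integrable_exp_power) auto
  fix u :: real assume u: "u > 0"
  show "\<bar>(exp (- c * u ^ p) - exp (- d * u ^ q)) / u\<bar> \<le> 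
         (c + d) * exp 1 * exp (- 1 * u ^ 1) + (exp (- c * u ^ p) + exp (- d * u ^ q))"
  proof (cases "u \<le> 1")
    case True
    have le: "0 \<le> 1 - exp (- c * u ^ p) \<and> 1 - exp (- c * u ^ p) \<le> c * u" if "c > 0" "p > 0" for c p
    proof -
      have "1 - c * u ^ p \<le> exp (- c * u ^ p)" using exp_ge_add_one_self[of "- c * u ^ p"] by simp
      moreover have "u ^ p \<le> u ^ 1" using u True that by (intro power_decreasing) auto
      ultimately show ?thesis using that u by (auto intro: order_trans[of _ "c * u ^ p"])
    qed
    have "\<bar>exp (- c * u ^ p) - exp (- d * u ^ q)\<bar> \<le> (c + d) * u"
      using le[of c p] le[of d q] assms unfolding abs_le_iff distrib_right by (intro conjI; linarith)
    then have "\<bar>(exp (- c * u ^ p) - exp (- d * u ^ q)) / u\<bar> \<le> c + d"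
      using u by (simp add: abs_divide field_simps)
    also have "\<dots> \<le> (c + d) * (exp 1 * exp (- 1 * u ^ 1))"
      using assms True by (simp add: exp_add[symmetric])
    finally show ?thesis by (simp add: add_increasing2 mult.assoc)
  next
    case False
    then have "\<bar>(exp (- c * u ^ p) - exp (- d * u ^ q)) / u\<bar> \<le> \<bar>exp (- c * u ^ p) - exp (- d * u ^ q)\<bar> / 1"
      unfolding abs_divide by (intro divide_left_mono) auto
    also have "\<dots> \<le> exp (- c * u ^ p) + exp (- d * u ^ q)"
      by (simp add: abs_le_iff)
    finally show ?thesis using assms by (simp add: add_increasing)
  qed
qed measurable

text \<open>Insert \<open>u powr s\<close> as a regulator. For s > 0 the two terms integrate
  separately to Gamma values, and Gamma(s/p)/p = Gamma(1 + s/p)/s turns their difference into a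
  difference quotient at 0. The limit s \<rightarrow> 0 is thus a derivative, in which Gamma'(1)
  supplies Euler's constant.\<close>

lemma integral_exp_power_frullani:
  fixes c d :: real and p q :: nat
  assumes "c > 0" "p > 0" "d > 0" "q > 0"
  shows "(LINT u|half_line. (exp (- c * u ^ p) - exp (- d * u ^ q)) / u) =
           (euler_mascheroni + ln d) / q - (euler_mascheroni + ln c) / p"
proof (rule LIMSEQ_unique)
  define f where "f u = exp (- c * u ^ p) - exp (- d * u ^ q)" for u :: real
  \<comment> \<open>Dominated convergence works along sequences, so s tends to 0 along one lying in
    (0,1]; there \<open>u powr (s n - 1)\<close> is at most \<open>1 / u + 1\<close>.\<close>
  define s where "s n = 1 / real (n + 2)" for n
  have s: "s n > 0" "s n \<le> 1" for n by (auto simp: s_def)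
  have "s \<longlonglongrightarrow> 0"
    unfolding s_def by real_asymp
  then have s0: "filterlim s (at 0) sequentially"
    using s by (auto simp: filterlim_at less_imp_neq[symmetric])
  have intf: "integrable half_line f"
    unfolding f_def using assms by (intro Bochner_Integration.integrable_diff integrable_exp_power)
  note int = integrable_exp_power_frullani[OF assms, folded f_def]
  show "(\<lambda>n. LINT u|half_line. u powr (s n - 1) * f u) \<longlonglongrightarrow> 
          (LINT u|half_line. (exp (- c * u ^ p) - exp (- d * u ^ q)) / u)"
    unfolding f_def[symmetric]
  proof (rule half_line_dominated_convergence)
    show "integrable half_line (\<lambda>u. \<bar>f u / u\<bar> + \<bar>f u\<bar>)"
      using int intf by (intro Bochner_Integration.integrable_add integrable_abs)
    fix u :: real assume u: "u > 0"
    have "(\<lambda>i. u powr (s i - 1) * f u) \<longlonglongrightarrow> u powr (0 - 1) * f u"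
      using u by (intro tendsto_intros \<open>s \<longlonglongrightarrow> 0\<close>) auto
    then show "(\<lambda>i. u powr (s i - 1) * f u) \<longlonglongrightarrow> f u / u"
      using u by (simp add: powr_minus field_simps)
    fix i
    have "u powr (s i - 1) \<le> 1 / u + 1"
    proof (cases "u \<le> 1")
      case True
      then have "u powr (s i - 1) \<le> u powr (-1)"
        using u s[of i] by (intro powr_mono') auto
      also have "\<dots> = 1 / u" using u by (simp add: powr_minus field_simps)
      finally show ?thesis using u by simp
    next
      case False
      then have "u powr (s i - 1) \<le> u powr 0"
        using u s[of i] by (intro powr_mono) auto
      then show ?thesis using u by (simp add: add_increasing)
    qed
    then have "u powr (s i - 1) * \<bar>f u\<bar> \<le> (1 / u + 1) * \<bar>f u\<bar>"
      by (intro mult_right_mono) auto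
    then show "\<bar>u powr (s i - 1) * f u\<bar> \<le> \<bar>f u / u\<bar> + \<bar>f u\<bar>"
      using u by (simp add: abs_mult algebra_simps)
  qed (unfold f_def, measurable)
  define F where "F r = c powr (- (r / p)) * Gamma (1 + r / p) - d powr (- (r / q)) * Gamma (1 + r / q)" for r
  \<comment> \<open>Here \<open>F 0 = 0\<close>; the form with \<open>0 + r\<close> and
    \<open>F 0\<close> is the difference quotient of \<open>DERIV_def\<close>.\<close>
  have "(LINT u|half_line. u powr (r - 1) * f u) = (F (0 + r) - F 0) / r" if r: "r > 0" for r
  proof -
    have "(LINT u|half_line. u powr (r - 1) * f u) =
          c powr (- (r / p)) * Gamma (r / p) / p - d powr (- (r / q)) * Gamma (r / q) / q"
      using has_bochner_integral_powr_exp_power[of r c p] has_bochner_integral_powr_exp_power[of r d q] r assms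
      unfolding f_def right_diff_distrib has_bochner_integral_iff
      by (subst Bochner_Integration.integral_diff) auto
    also have "\<dots> = (F (0 + r) - F 0) / r"
    proof -
      have "Gamma (1 + r / n) = r / n * Gamma (r / n)" if "n > 0" for n :: nat
      proof -
        have "r / n \<notin> \<int>\<^sub>\<le>\<^sub>0"
          using r that by (auto dest!: nonpos_Ints_nonpos simp: field_simps)
        from Gamma_plus1[OF this] show ?thesis by (simp add: add.commute)
      qed
      from this[of p] this[of q] assms
      have "F r = r * (c powr (- (r / p)) * Gamma (r / p) / p - d powr (- (r / q)) * Gamma (r / q) / q)"
        unfolding F_def by (simp add: algebra_simps)
      moreover have "F 0 = 0" using assms by (simp add: F_def)
      ultimately show ?thesis using r by simp
    qed
    finally show ?thesis .
  qed
  then have eq: "(LINT u|half_line. u powr (s n - 1) * f u) = (F (0 + s n) - F 0) / s n" for n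
    using s by blast
  have "(F has_field_derivative ((euler_mascheroni + ln d) / q - (euler_mascheroni + ln c) / p)) (at 0)"
    unfolding F_def using assms
    by (auto intro!: derivative_eq_intros simp: field_simps)
  then have "(\<lambda>h. (F (0 + h) - F 0) / h) \<midarrow>0\<rightarrow> ((euler_mascheroni + ln d) / q - (euler_mascheroni + ln c) / p)"
    by (simp add: DERIV_def)
  from filterlim_compose[OF this s0]
  show "(\<lambda>n. LINT u|half_line. u powr (s n - 1) * f u) \<longlonglongrightarrow>
          (euler_mascheroni + ln d) / q - (euler_mascheroni + ln c) / p"
    by (simp add: eq)
qed

subsection \<open>The digamma function\<close>

text \<open>Logarithmic derivative of Legendre's duplication formula. The right half-plane is open
  and contains neither poles nor zeros of Gamma, so both sides can be differentiated and the common
  factor cancelled.\<close>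

lemma Digamma_duplication:
  fixes z :: complex
  assumes "Re z > 0"
  shows "Digamma z + Digamma (z + 1/2) = 2 * Digamma (2 * z) - 2 * of_real (ln 2)"
proof -
  have nonpos: "w \<notin> \<int>\<^sub>\<le>\<^sub>0" if "Re w > 0" for w :: complex
    using that by (auto elim!: nonpos_Ints_cases)
  define E where "E w = exp ((1 - 2 * w) * of_real (ln 2)) * of_real (sqrt pi)" for w :: complex
  have "((\<lambda>w. Gamma w * Gamma (w + 1/2)) has_field_derivative
          Gamma z * Gamma (z + 1/2) * (Digamma z + Digamma (z + 1/2))) (at z)"
    using assms by (auto intro!: derivative_eq_intros nonpos simp: algebra_simps)
  moreover have "eventually (\<lambda>w. Gamma w * Gamma (w + 1/2) = E w * Gamma (2 * w)) (nhds z)"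
  proof (rule eventually_nhds_in_open[THEN eventually_mono])
    show "open {w. Re w > 0}" by (simp add: open_halfspace_Re_gt)
    show "Gamma w * Gamma (w + 1/2) = E w * Gamma (2 * w)" if "w \<in> {w. Re w > 0}" for w
      using that unfolding E_def by (intro Gamma_legendre_duplication nonpos) auto
  qed (use assms in auto)
  ultimately have "((\<lambda>w. E w * Gamma (2 * w)) has_field_derivative
          Gamma z * Gamma (z + 1/2) * (Digamma z + Digamma (z + 1/2))) (at z)"
    by (simp only: DERIV_cong_ev[OF refl _ refl])
  moreover have "((\<lambda>w. E w * Gamma (2 * w)) has_field_derivative
          E z * Gamma (2 * z) * (2 * Digamma (2 * z) - 2 * of_real (ln 2))) (at z)"
    unfolding E_def using assms by (auto intro!: derivative_eq_intros nonpos simp: algebra_simps)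
  ultimately have "Gamma z * Gamma (z + 1/2) * (Digamma z + Digamma (z + 1/2)) =
      E z * Gamma (2 * z) * (2 * Digamma (2 * z) - 2 * of_real (ln 2))"
    by (rule DERIV_unique)
  moreover have "Gamma z * Gamma (z + 1/2) = E z * Gamma (2 * z)"
    unfolding E_def using assms by (intro Gamma_legendre_duplication nonpos) auto
  moreover have "E z * Gamma (2 * z) \<noteq> 0"
    using nonpos[of "2 * z"] assms by (simp add: E_def Gamma_eq_zero_iff)
  ultimately show ?thesis by simp
qed

text \<open>Logarithmic derivative of Euler's reflection formula; in the strip both Gamma arguments
  avoid the poles and the sine does not vanish.\<close>

lemma Digamma_reflection:
  fixes z :: complex
  assumes "0 < Re z" "Re z < 1"
  shows "Digamma (1 - z) - Digamma z = of_real pi * cot (of_real pi * z)"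
proof -
  have nonpos: "w \<notin> \<int>\<^sub>\<le>\<^sub>0" if "Re w > 0" for w :: complex
    using that by (auto elim!: nonpos_Ints_cases)
  have "z \<notin> \<int>" using assms by (auto elim!: Ints_cases)
  then have sin: "sin (of_real pi * z) \<noteq> 0"
    by (subst sin_eq_0) (auto simp: mult.commute)
  have "((\<lambda>w. Gamma w * Gamma (1 - w)) has_field_derivative
          Gamma z * Gamma (1 - z) * (Digamma z - Digamma (1 - z))) (at z)"
    using assms by (auto intro!: derivative_eq_intros nonpos simp: algebra_simps)
  moreover have "((\<lambda>w. of_real pi / sin (of_real pi * w)) has_field_derivative
          (of_real pi / sin (of_real pi * z)) * - (of_real pi * cot (of_real pi * z))) (at z)"
    using sin by (auto intro!: derivative_eq_intros simp: cot_def power2_eq_square)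
  ultimately have "Gamma z * Gamma (1 - z) * (Digamma z - Digamma (1 - z)) =
      (of_real pi / sin (of_real pi * z)) * - (of_real pi * cot (of_real pi * z))"
    unfolding Gamma_reflection_complex by (rule DERIV_unique)
  moreover have "of_real pi / sin (of_real pi * z) \<noteq> 0" using sin by simp
  ultimately have "Digamma z - Digamma (1 - z) = - (of_real pi * cot (of_real pi * z))"
    unfolding Gamma_reflection_complex by (metis mult_left_cancel)
  then show ?thesis by (simp add: algebra_simps)
qed

text \<open>At real part \<pi>/4 the squares of sine and cosine are both 1/2, so the squared modulus
  of the complex sine collapses to half of cosh(\<pi>t).\<close>

lemma Re_cot_quarter:
  fixes t :: real
  shows "Re (cot (of_real pi * (1/4 - \<i> * of_real t / 2))) = 1 / cosh (pi * t)"
proof -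
  define b where "b = pi * t / 2"
  define a where "a = pi / 4"
  have eq: "of_real pi * (1/4 - \<i> * of_real t / 2) = Complex a (- b)"
    by (simp add: complex_eq_iff a_def b_def)
  have sq: "sin a ^ 2 = 1/2" "cos a ^ 2 = 1/2" "sin a * cos a = 1/2"
    by (simp_all add: a_def sin_45 cos_45 power_divide)
  have parts: "Re (sin (Complex a (- b))) = sin a * cosh b" "Im (sin (Complex a (- b))) = - cos a * sinh b"
    "Re (cos (Complex a (- b))) = cos a * cosh b" "Im (cos (Complex a (- b))) = sin a * sinh b"
    by (simp_all add: Re_sin Im_sin Re_cos Im_cos cosh_def sinh_def algebra_simps diff_divide_distrib)
  have "Re (cot (Complex a (- b))) = (sin a * cos a * (cosh b ^ 2 - sinh b ^ 2)) /
          (sin a ^ 2 * cosh b ^ 2 + cos a ^ 2 * sinh b ^ 2)"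
    unfolding cot_def Re_divide parts
    by (rule arg_cong2[where f = "(/)"]) (simp_all add: power2_eq_square algebra_simps)
  also have "\<dots> = 1 / (cosh b ^ 2 + sinh b ^ 2)"
    unfolding sq cosh_square_eq by (simp add: add_divide_distrib[symmetric])
  also have "cosh b ^ 2 + sinh b ^ 2 = cosh (2 * b)"
    by (simp add: cosh_double)
  finally show ?thesis by (simp add: eq b_def)
qed

lemma Re_euler_mascheroni: "Re euler_mascheroni = euler_mascheroni"
  by (metis Re_complex_of_real of_real_euler_mascheroni)

text \<open>The real part of each term of the Digamma series depends on the imaginary part of
  \<open>z\<close> only through its square.\<close>

lemma Re_Digamma_cnj: "Re (Digamma (cnj z)) = Re (Digamma z)" if "z \<noteq> 0" for z :: complex
proof -
  have "Re (Digamma w) = (\<Sum>k. Re (inverse (of_nat (Suc k)) - inverse (w + of_nat k))) - euler_mascheroni" 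
    if "w \<noteq> 0" for w :: complex
    using Re_suminf[OF summable_Digamma[OF that]]
    by (simp only: Digamma_def minus_complex.sel Re_euler_mascheroni)
  from this[of z] this[of "cnj z"] that show ?thesis by simp
qed

text \<open>Duplication at z = 1/4 + it/2 gives the mean of Digamma at z and z + 1/2, plus log 2. By
  reflection these two values differ in real part by \<pi>/cosh(\<pi>t), half of which is exactly
  the hyperbolic term in \<open>Psi\<close>.\<close>

lemma Psi_eq_Digamma: "Psi t = ln pi - Re (Digamma (1/4 + \<i> * of_real t / 2))"
proof -
  define z where "z = 1/4 + \<i> * complex_of_real t / 2"
  have z: "Re z = 1/4" "Im z = t / 2" by (auto simp: z_def)
  have nz: "1/2 + \<i> * complex_of_real t \<notin> \<int>\<^sub>\<le>\<^sub>0"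
    by (auto elim!: nonpos_Ints_cases simp: complex_eq_iff)
  have "deriv Gamma (1/2 + \<i> * complex_of_real t) / Gamma (1/2 + \<i> * complex_of_real t)
          = Digamma (1/2 + \<i> * of_real t)"
    using nz by (simp add: DERIV_imp_deriv[OF has_field_derivative_Gamma] Gamma_eq_zero_iff)
  moreover have "1/2 + \<i> * complex_of_real t = 2 * z" by (simp add: z_def)
  ultimately have "Psi t = ln 2 + ln pi + pi / (2 * cosh (pi * t)) - Re (Digamma (2 * z))"
    by (simp only: Psi_def) (simp add: ln_mult)
  moreover have "2 * Digamma (2 * z) = Digamma z + Digamma (z + 1/2) + 2 * of_real (ln 2)"
    using Digamma_duplication[of z] z by (simp add: algebra_simps)
  then have "Re (2 * Digamma (2 * z)) = Re (Digamma z + Digamma (z + 1/2) + 2 * of_real (ln 2))"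
    by simp
  then have "2 * Re (Digamma (2 * z)) = Re (Digamma z) + Re (Digamma (z + 1/2)) + 2 * ln 2"
    by simp
  moreover have "Re (Digamma (z + 1/2)) = pi / cosh (pi * t) + Re (Digamma z)"
  proof -
    \<comment> \<open>This holds because Re z = 1/4; it makes reflection at the conjugate of
      \<open>z\<close> reach \<open>z + 1/2\<close>.\<close>
    have "1 - cnj z = z + 1/2" by (simp add: complex_eq_iff z)
    then have "Digamma (z + 1/2) = of_real pi * cot (of_real pi * cnj z) + Digamma (cnj z)"
      using Digamma_reflection[of "cnj z"] z unfolding \<open>1 - cnj z = z + 1/2\<close> by (simp add: diff_eq_eq[of "Digamma _"])
    moreover have "Re (cot (of_real pi * cnj z)) = 1 / cosh (pi * t)"
      using Re_cot_quarter[of t] by (simp add: z_def)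
    moreover have "Re (Digamma (cnj z)) = Re (Digamma z)"
      using z by (intro Re_Digamma_cnj) auto
    ultimately show ?thesis by simp
  qed
  moreover have "pi / (2 * cosh (pi * t)) = pi / cosh (pi * t) / 2" by simp
  ultimately show ?thesis unfolding z_def[symmetric] by linarith
qed

lemma Re_Digamma_quarter_sums:
  "(\<lambda>k. 1 / (real k + 1) - (real k + 1/4) / ((real k + 1/4)\<^sup>2 + (t / 2)\<^sup>2)) sums
     (Re (Digamma (1/4 + \<i> * of_real t / 2)) + euler_mascheroni)"
proof -
  define z where "z = 1/4 + \<i> * complex_of_real t / 2"
  have z: "Re z = 1/4" "Im z = t / 2" by (auto simp: z_def)
  then have "z \<noteq> 0" by auto
  from sums_Re[OF summable_sums[OF summable_Digamma[OF this]]]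
  have "(\<lambda>k. Re (inverse (of_nat (Suc k)) - inverse (z + of_nat k))) sums (Re (Digamma z) + euler_mascheroni)"
    by (simp only: Digamma_def minus_complex.sel Re_euler_mascheroni) simp
  moreover have "Re (inverse (of_nat (Suc k)) - inverse (z + of_nat k)) = 
      1 / (real k + 1) - (real k + 1/4) / ((real k + 1/4)\<^sup>2 + (t / 2)\<^sup>2)" for k
    by (simp add: z add.commute power2_eq_square)
  ultimately show ?thesis by (simp add: z_def)
qed

subsection \<open>The Bernoulli generating function\<close>

text \<open>The bracket in the integral formula for \<open>Phi\<close>. It is (1 - g(u))/u, with g
  the Bernoulli generating function at y = 3/4, so the poles at 0 cancel.\<close>

definition bernoulli_kernel :: "real \<Rightarrow> real" where
  "bernoulli_kernel u = 1 / u - exp (3/4 * u) / (exp u - 1)"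

text \<open>After subtracting the partial sum only powers above \<open>N\<close> remain, so the
  quotient by \<open>u ^ Suc N\<close> extends to a function continuous at 0, which is bounded near
  0.\<close>

lemma has_fps_expansion_remainder_bound:
  fixes F :: "real fps"
  assumes "f has_fps_expansion F"
  shows "\<exists>C. \<exists>r>0. \<forall>u. 0 < u \<longrightarrow> u < r \<longrightarrow>
           \<bar>f u - (\<Sum>n\<le>N. fps_nth F n * u ^ n)\<bar> \<le> C * u ^ Suc N"
proof -
  define P where "P = (\<Sum>n\<le>N. fps_const (fps_nth F n) * fps_X ^ n)"
  have P: "(\<lambda>u. \<Sum>n\<le>N. fps_nth F n * u ^ n) has_fps_expansion P"
    unfolding P_def by (intro fps_expansion_intros)
  have nth: "fps_nth P n = (if n \<le> N then fps_nth F n else 0)" for n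
    by (simp add: P_def fps_sum_nth fps_X_power_nth if_distrib cong: if_cong)
  define G where "G = (\<lambda>u. if u = 0 then fps_nth (F - P) (Suc N) 
                            else (f u - (\<Sum>n\<le>N. fps_nth F n * u ^ n)) / u ^ Suc N)"
  obtain r where r: "r > 0" "\<And>u. 0 < u \<Longrightarrow> u < r \<Longrightarrow> \<bar>G u\<bar> \<le> \<bar>G 0\<bar> + 1"
  \<comment> \<open>The zero series has subdegree 0 and cannot be shifted, so it is treated apart:
    there \<open>f\<close> agrees with its partial sum near 0.\<close>
  proof (cases "F - P = 0")
    case True
    then have "(\<lambda>u. f u - (\<Sum>n\<le>N. fps_nth F n * u ^ n)) has_fps_expansion 0"
      using has_fps_expansion_diff[OF assms P] by simp
    then have "eventually (\<lambda>u. f u - (\<Sum>n\<le>N. fps_nth F n * u ^ n) = 0) (nhds 0)"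
      by (auto simp: has_fps_expansion_def elim: eventually_mono)
    then obtain r where "r > 0" "\<And>u. dist u 0 < r \<Longrightarrow> f u - (\<Sum>n\<le>N. fps_nth F n * u ^ n) = 0"
      by (auto simp: eventually_nhds_metric)
    then show ?thesis by (intro that[of r]) (auto simp: G_def)
  next
    case False
    have "Suc N \<le> subdegree (F - P)"
      using False by (intro subdegree_geI) (auto simp: nth)
    then have "G has_fps_expansion fps_shift (Suc N) (F - P)"
      unfolding G_def by (rule has_fps_expansion_shift[OF has_fps_expansion_diff[OF assms P] _ refl])
    then have "continuous (at 0) G" by (rule has_fps_expansion_imp_continuous)
    then have "\<exists>r>0. \<forall>u. dist u 0 < r \<longrightarrow> dist (G u) (G 0) < 1"
      unfolding continuous_at_eps_delta by (rule allE[of _ 1]) simp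
    then obtain r where r: "r > 0" "\<forall>u. dist u 0 < r \<longrightarrow> dist (G u) (G 0) < 1" by (elim exE conjE)
    show ?thesis
    proof (rule that[OF r(1)])
      fix u assume "0 < u" "u < r"
      then have "\<bar>G u - G 0\<bar> < 1" using r(2)[rule_format, of u] by (simp add: dist_real_def)
      then show "\<bar>G u\<bar> \<le> \<bar>G 0\<bar> + 1" by linarith
    qed
  qed
  show ?thesis
  proof (intro exI conjI allI impI)
    fix u :: real assume u: "0 < u" "u < r"
    have "f u - (\<Sum>n\<le>N. fps_nth F n * u ^ n) = G u * u ^ Suc N"
      using u by (simp add: G_def)
    then have "\<bar>f u - (\<Sum>n\<le>N. fps_nth F n * u ^ n)\<bar> = \<bar>G u\<bar> * u ^ Suc N"
      using u by (simp add: abs_mult)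
    also have "\<dots> \<le> (\<bar>G 0\<bar> + 1) * u ^ Suc N"
      using u r(2)[OF u] by (intro mult_right_mono) auto
    finally show "\<bar>f u - (\<Sum>n\<le>N. fps_nth F n * u ^ n)\<bar> \<le> (\<bar>G 0\<bar> + 1) * u ^ Suc N" .
  qed (fact r)
qed

text \<open>This carries the formal definition of \<open>bernoulli_poly\<close> over to an actual
  function. The value 1 at 0 is the quotient of the two leading coefficients, both series having
  subdegree 1.\<close>

lemma bernoulli_generating_function_has_fps_expansion:
  "(\<lambda>u. if u = 0 then 1 else u * exp (y * u) / (exp u - 1)) has_fps_expansion
     Abs_fps (\<lambda>n. bernoulli_poly n y / fact n)"
proof -
  have nth1: "fps_nth (fps_exp 1 - 1 :: real fps) 1 \<noteq> 0"
    by simp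
  then have nz: "fps_exp 1 - 1 \<noteq> (0 :: real fps)"
    by (metis fps_zero_nth)
  have sub: "subdegree (fps_exp 1 - 1 :: real fps) = 1"
    by (rule subdegreeI) (use nth1 in auto)
  moreover have "subdegree (fps_X * fps_exp y :: real fps) = 1"
    by (rule subdegreeI) auto
  ultimately have "(\<lambda>u. if u = 0 then 1 else u * exp (y * u) / (exp u - 1)) has_fps_expansion
      (fps_X * fps_exp y / (fps_exp 1 - 1))"
    using nz by (intro has_fps_expansion_divide fps_expansion_intros) simp_all
  moreover have "Abs_fps (\<lambda>n. bernoulli_poly n y / fact n) = fps_X * fps_exp y / (fps_exp 1 - 1)"
    by (simp add: bernoulli_poly_def fps_eq_iff)
  ultimately show ?thesis by simp
qed

lemma bernoulli_poly_0: "bernoulli_poly 0 y = 1"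
proof -
  have "fps_nth (Abs_fps (\<lambda>n. bernoulli_poly n y / fact n) * (fps_exp 1 - 1)) 1 = fps_nth (fps_X * fps_exp y) 1"
    by (simp only: bernoulli_poly_generating_function)
  then show ?thesis by (simp add: fps_mult_nth)
qed

lemma bernoulli_kernel_bounded:
  assumes "u \<ge> 1"
  shows "\<bar>bernoulli_kernel u\<bar> \<le> 3"
proof -
  have e: "exp u \<ge> 2" using exp_ge_add_one_self[of u] assms by linarith
  have "exp (3/4 * u) \<le> exp u" using assms by simp
  also have "exp u \<le> 2 * (exp u - 1)" using e by simp
  finally have "exp (3/4 * u) \<le> 2 * (exp u - 1)" .
  then have "exp (3/4 * u) / (exp u - 1) \<le> 2"
    using assms by (subst pos_divide_le_eq) auto
  moreover have "exp (3/4 * u) / (exp u - 1) \<ge> 0" using assms by simp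
  moreover have "1 / u \<le> 1" "1 / u \<ge> 0" using assms by (auto simp: field_simps)
  ultimately show ?thesis unfolding bernoulli_kernel_def by linarith
qed

text \<open>The Gaussian is integrated over the whole half-line, so the Taylor bound has to be
  global. Three ranges are glued: the power series near 0, compactness up to 1, and boundedness of
  the kernel beyond 1, where \<open>u ^ N\<close> dominates all lower powers.\<close>

lemma bernoulli_kernel_remainder:
  obtains C where "C \<ge> 0"
    "\<And>u. u > 0 \<Longrightarrow> \<bar>bernoulli_kernel u + (\<Sum>n=1..N. bernoulli_poly n (3/4) / fact n * u ^ (n - 1))\<bar> \<le> C * u ^ N"
proof -
  define b where "b n = bernoulli_poly n (3/4) / fact n" for n
  define S where "S u = (\<Sum>n=1..N. b n * u ^ (n - 1))" for u
  obtain C r where r: "r > 0" "\<And>u. 0 < u \<Longrightarrow> u < r \<Longrightarrow> 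
    \<bar>(if u = 0 then 1 else u * exp (3/4 * u) / (exp u - 1)) - (\<Sum>n\<le>N. b n * u ^ n)\<bar> \<le> C * u ^ Suc N"
    using has_fps_expansion_remainder_bound[OF bernoulli_generating_function_has_fps_expansion[of "3/4"], of N]
    unfolding b_def fps_nth_Abs_fps by blast
  have near: "\<bar>bernoulli_kernel u + S u\<bar> \<le> C * u ^ N" if u: "0 < u" "u < r" for u
  proof -
    have "(\<Sum>n\<le>N. b n * u ^ n) = b 0 + (\<Sum>n=1..N. b n * u ^ n)"
      by (simp add: atMost_atLeast0 sum.atLeast_Suc_atMost)
    also have "(\<Sum>n=1..N. b n * u ^ n) = u * S u"
      unfolding S_def sum_distrib_left
    proof (rule sum.cong)
      fix n assume "n \<in> {1..N}"
      then have "u ^ n = u * u ^ (n - 1)" by (cases n) auto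
      then show "b n * u ^ n = u * (b n * u ^ (n - 1))" by simp
    qed simp
    \<comment> \<open>Multiplied by \<open>u\<close>, the term \<open>1 / u\<close> becomes 1 and
      cancels against \<open>b 0 = 1\<close>; this explains the sign and the exponents
      \<open>n - 1\<close>.\<close>
    finally have "u * (bernoulli_kernel u + S u) = 
        - ((if u = 0 then 1 else u * exp (3/4 * u) / (exp u - 1)) - (\<Sum>n\<le>N. b n * u ^ n))"
      using u by (simp add: bernoulli_kernel_def b_def bernoulli_poly_0 algebra_simps)
    then have "u * \<bar>bernoulli_kernel u + S u\<bar> \<le> C * u ^ Suc N"
      using r(2)[OF u] u by (metis abs_minus_cancel abs_mult abs_of_pos)
    also have "C * u ^ Suc N = u * (C * u ^ N)" by simp
    finally show ?thesis using u by (simp only: mult_le_cancel_left_pos)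
  qed
  define D where "D = (\<Sum>n=1..N. \<bar>b n\<bar>)"
  have "D \<ge> 0" unfolding D_def by (intro sum_nonneg) auto
  have far: "\<bar>bernoulli_kernel u + S u\<bar> \<le> (3 + D) * u ^ N" if u: "u \<ge> 1" for u
  proof -
    have "\<bar>S u\<bar> \<le> (\<Sum>n=1..N. \<bar>b n\<bar> * u ^ N)"
      unfolding S_def
    proof (rule order_trans[OF sum_abs sum_mono])
      fix n assume "n \<in> {1..N}"
      then have "u ^ (n - 1) \<le> u ^ N" using u by (intro power_increasing) auto
      then show "\<bar>b n * u ^ (n - 1)\<bar> \<le> \<bar>b n\<bar> * u ^ N"
        using u by (simp add: abs_mult mult_left_mono)
    qed
    then have "\<bar>S u\<bar> \<le> D * u ^ N" by (simp add: D_def sum_distrib_right)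
    moreover have "\<bar>bernoulli_kernel u\<bar> \<le> 3 * u ^ N"
      using bernoulli_kernel_bounded[OF u] one_le_power[OF u, of N] by linarith
    ultimately show ?thesis by (simp add: algebra_simps)
  qed
  \<comment> \<open>For \<open>r > 1\<close> this interval is empty and the two outer ranges already
    overlap.\<close>
  have "continuous_on {r..1} (\<lambda>u. (bernoulli_kernel u + S u) / u ^ N)"
    unfolding bernoulli_kernel_def S_def using r(1) by (auto intro!: continuous_intros)
  then have "compact ((\<lambda>u. (bernoulli_kernel u + S u) / u ^ N) ` {r..1})"
    by (intro compact_continuous_image) auto
  then obtain M where M: "\<And>u. r \<le> u \<Longrightarrow> u \<le> 1 \<Longrightarrow> \<bar>(bernoulli_kernel u + S u) / u ^ N\<bar> \<le> M"
    using compact_imp_bounded by (force simp: bounded_iff)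
  have mid: "\<bar>bernoulli_kernel u + S u\<bar> \<le> M * u ^ N" if "r \<le> u" "u \<le> 1" for u
    using M[OF that] that r by (simp add: abs_divide field_simps)
  define E where "E = max (max C M) (3 + D)"
  show thesis
  proof (rule that[of E])
    show "E \<ge> 0" using \<open>D \<ge> 0\<close> by (simp add: E_def le_max_iff_disj)
    fix u :: real assume u: "u > 0"
    have "X \<le> E \<Longrightarrow> X * u ^ N \<le> E * u ^ N" for X using u by (intro mult_right_mono) auto
    moreover have "C \<le> E" "M \<le> E" "3 + D \<le> E" by (auto simp: E_def)
    ultimately have "\<bar>bernoulli_kernel u + S u\<bar> \<le> E * u ^ N"
      using near[of u] mid[of u] far[of u] u by (meson linorder_not_le order_trans linorder_le_cases)
    then show "\<bar>bernoulli_kernel u + (\<Sum>n=1..N. bernoulli_poly n (3/4) / fact n * u ^ (n - 1))\<bar> \<le> E * u ^ N"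
      by (simp add: S_def b_def)
  qed
qed

subsection \<open>Gaussian integrals\<close>

lemma integral_nonneg_eq_half_line:
  fixes f :: "real \<Rightarrow> real"
  shows "(LBINT t:{0..}. f t) = (LINT t|half_line. f t)"
  unfolding set_lebesgue_integral_def
  by (subst integral_restrict_space, simp)
     (rule integral_discrete_difference[where X = "{0}"], auto simp: indicator_def)

text \<open>The real part of the characteristic function of the standard normal law, rescaled;
  evenness of the integrand accounts for the factor 1/2.\<close>

lemma integral_gaussian_cos:
  fixes x \<omega> :: real
  assumes "x > 0"
  shows "(LINT t|half_line. exp (- x * t\<^sup>2) * cos (\<omega> * t)) = sqrt (pi / x) / 2 * exp (- (\<omega>\<^sup>2 / (4 * x)))"
proof -
  interpret real_distribution std_normal_distribution by (rule real_dist_normal_dist)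
  \<comment> \<open>Under y = sqrt(2x) t the normal density becomes a multiple of
    \<open>exp (- x * t\<^sup>2)\<close>, and this choice turns \<tau>y into \<omega>t.\<close>
  define \<tau> where "\<tau> = \<omega> / sqrt (2 * x)"
  define f where "f t = exp (- x * t\<^sup>2) * cos (\<omega> * t)" for t :: real
  have "integrable std_normal_distribution (\<lambda>y. iexp (\<tau> * y))"
    by (rule integrable_iexp) auto
  then have "(LINT y|std_normal_distribution. cos (\<tau> * y)) = exp (- \<tau>\<^sup>2 / 2)"
    using arg_cong[OF fun_cong[OF char_std_normal_distribution, of \<tau>], of Re]
    unfolding char_def by (subst (asm) integral_Re[symmetric]) (auto simp: Re_exp)
  then have "(LINT y|lborel. std_normal_density y * cos (\<tau> * y)) = exp (- \<tau>\<^sup>2 / 2)"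
    by (subst (asm) integral_density) auto
  also have "(LINT y|lborel. std_normal_density y * cos (\<tau> * y)) =
      sqrt (2 * x) * (LINT t|lborel. std_normal_density (sqrt (2 * x) * t) * cos (\<tau> * (sqrt (2 * x) * t)))"
    using assms by (subst lborel_integral_real_affine[where c = "sqrt (2 * x)" and t = 0]) auto
  also have "(\<lambda>t. std_normal_density (sqrt (2 * x) * t) * cos (\<tau> * (sqrt (2 * x) * t))) = (\<lambda>t. f t / sqrt (2 * pi))"
    using assms by (auto simp: fun_eq_iff f_def std_normal_density_def \<tau>_def power_mult_distrib)
  finally have "sqrt (2 * x) / sqrt (2 * pi) * (LINT t|lborel. f t) = exp (- \<tau>\<^sup>2 / 2)"
    by simp
  then have full: "(LINT t|lborel. f t) = sqrt (pi / x) * exp (- \<tau>\<^sup>2 / 2)"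
    using assms by (simp add: real_sqrt_mult real_sqrt_divide field_simps)
  have "integrable half_line f"
    by (rule integrable_half_line_bound[OF integrable_exp_power[of x 2]])
       (use assms in \<open>auto simp: f_def[abs_def] abs_mult mult_left_le\<close>)
  then have "has_bochner_integral lborel (\<lambda>t. indicator {0<..} t *\<^sub>R f t) (integral\<^sup>L half_line f)"
    by (subst has_bochner_integral_restrict_space[symmetric]) (auto simp: has_bochner_integral_iff)
  also have "?this \<longleftrightarrow> has_bochner_integral lborel (\<lambda>t. indicator {0..} t *\<^sub>R f t) (integral\<^sup>L half_line f)"
    by (rule has_bochner_integral_discrete_difference[where X = "{0}"]) (auto simp: indicator_def)
  finally have "has_bochner_integral lborel f (2 *\<^sub>R integral\<^sup>L half_line f)"
    by (rule has_bochner_integral_even_function) (simp add: f_def)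
  then have "2 * integral\<^sup>L half_line f = (LINT t|lborel. f t)"
    by (simp add: has_bochner_integral_iff)
  also have "\<tau>\<^sup>2 / 2 = \<omega>\<^sup>2 / (4 * x)"
    using assms by (simp add: \<tau>_def power_divide)
  ultimately show ?thesis
    using full by (simp add: f_def[abs_def])
qed

lemma laplace_cos:
  fixes a \<omega> :: real
  assumes "a > 0"
  shows "integrable half_line (\<lambda>u. exp (- a * u) * cos (\<omega> * u))"
    and "(LINT u|half_line. exp (- a * u) * cos (\<omega> * u)) = a / (a\<^sup>2 + \<omega>\<^sup>2)"
proof -
  define f where "f u = exp (- a * u) * cos (\<omega> * u)" for u :: real
  \<comment> \<open>An antiderivative of \<open>f\<close> that vanishes at infinity, so the integral
    is \<open>- F 0\<close>.\<close>
  define F where "F u = exp (- a * u) * (\<omega> * sin (\<omega> * u) - a * cos (\<omega> * u)) / (a\<^sup>2 + \<omega>\<^sup>2)" for u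
  show int: "integrable half_line (\<lambda>u. exp (- a * u) * cos (\<omega> * u))"
    by (rule integrable_half_line_bound[OF integrable_exp_power[of a 1]])
       (use assms in \<open>auto simp: abs_mult mult_left_le\<close>)
  have F: "(F has_field_derivative f u) (at u)" for u
  proof -
    have "((\<lambda>u. exp (- a * u) * (\<omega> * sin (\<omega> * u) - a * cos (\<omega> * u))) has_field_derivative
            (a\<^sup>2 + \<omega>\<^sup>2) * f u) (at u)"
      unfolding f_def by (auto intro!: derivative_eq_intros simp: algebra_simps power2_eq_square)
    from DERIV_cdivide[OF this, of "a\<^sup>2 + \<omega>\<^sup>2"] show ?thesis
      using assms by (simp add: F_def[abs_def])
  qed
  have "(LBINT u=0..\<infinity>. f u) = 0 - F 0"
  proof (rule interval_integral_FTC_integrable[where F = F])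
    show "(F has_vector_derivative f u) (at u)" for u
      using F by (simp add: has_real_derivative_iff_has_vector_derivative)
    show "isCont f u" for u unfolding f_def by (intro continuous_intros)
    show "set_integrable lborel (einterval 0 \<infinity>) f"
      using int by (simp add: einterval_def set_integrable_def integrable_restrict_space f_def[abs_def]
          zero_ereal_def greaterThan_def)
    show "((F \<circ> real_of_ereal) \<longlongrightarrow> F 0) (at_right 0)"
    proof -
      have "isCont F 0" using F[of 0] by (rule DERIV_isCont)
      then have "(F \<longlongrightarrow> F 0) (at_right 0)"
        by (simp add: isCont_def filterlim_at_split)
      then show ?thesis by (simp add: zero_ereal_def ereal_tendsto_simps)
    qed
    have "(F \<longlongrightarrow> 0) at_top"
    proof (rule Lim_null_comparison, rule always_eventually, rule allI)
      fix u
      have "\<bar>\<omega> * sin (\<omega> * u)\<bar> \<le> \<bar>\<omega>\<bar>" "\<bar>a * cos (\<omega> * u)\<bar> \<le> \<bar>a\<bar>"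
        by (auto simp: abs_mult mult_left_le)
      then have "\<bar>\<omega> * sin (\<omega> * u) - a * cos (\<omega> * u)\<bar> \<le> \<bar>\<omega>\<bar> + \<bar>a\<bar>" by linarith
      then show "norm (F u) \<le> exp (- a * u) * (\<bar>\<omega>\<bar> + \<bar>a\<bar>) / (a\<^sup>2 + \<omega>\<^sup>2)"
        by (auto simp: F_def abs_divide abs_mult intro!: divide_right_mono)
    next
      have "((\<lambda>u. exp (- a * u)) \<longlongrightarrow> 0) at_top"
        using assms by real_asymp
      then show "((\<lambda>u. exp (- a * u) * (\<bar>\<omega>\<bar> + \<bar>a\<bar>) / (a\<^sup>2 + \<omega>\<^sup>2)) \<longlongrightarrow> 0) at_top"
        by (intro tendsto_divide_zero tendsto_mult_left_zero)
    qed
    then show "((F \<circ> real_of_ereal) \<longlongrightarrow> 0) (at_left \<infinity>)"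
      by (simp add: ereal_tendsto_simps)
  qed auto
  then show "(LINT u|half_line. exp (- a * u) * cos (\<omega> * u)) = a / (a\<^sup>2 + \<omega>\<^sup>2)"
    by (simp add: interval_lebesgue_integral_def set_lebesgue_integral_def einterval_def zero_ereal_def
        integral_restrict_space f_def[abs_def] F_def greaterThan_def)
qed

lemma sigma_finite_half_line: "sigma_finite_measure half_line"
  by (rule sigma_finite_measure_restrict_space) (auto intro: lborel.sigma_finite_measure_axioms)

text \<open>Write the Lorentzian as the Laplace transform at \<open>b\<close> of u \<mapsto>
  cos(tu/2) and swap the integrals. The inner one is then a Gaussian cosine integral of frequency
  u/2, whence the exponent -u^2/(16x).\<close>

lemma integral_gaussian_lorentzian:
  fixes x b :: real
  assumes "x > 0" "b > 0"
  shows "(LINT t|half_line. exp (- x * t\<^sup>2) * (b / (b\<^sup>2 + (t / 2)\<^sup>2))) =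
           sqrt (pi / x) / 2 * (LINT u|half_line. exp (- (1 / (16 * x)) * u\<^sup>2) * exp (- b * u))"
proof -
  interpret H: sigma_finite_measure half_line by (rule sigma_finite_half_line)
  interpret HH: pair_sigma_finite half_line half_line ..
  define f where "f t u = exp (- x * t\<^sup>2) * (exp (- b * u) * cos (t / 2 * u))" for t u :: real
  have [measurable]: "(\<lambda>z. z) \<in> borel_measurable half_line" by measurable
  have meas: "case_prod f \<in> borel_measurable (half_line \<Otimes>\<^sub>M half_line)"
    unfolding f_def by measurable
  have int: "integrable (half_line \<Otimes>\<^sub>M half_line) (case_prod f)"
  proof (rule Bochner_Integration.integrable_bound[OF _ meas])
    show "integrable (half_line \<Otimes>\<^sub>M half_line) (\<lambda>(t, u). exp (- x * t\<^sup>2) * exp (- b * u))"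
    proof (rule HH.Fubini_integrable)
      show "AE t in half_line. integrable half_line (\<lambda>u. case (t, u) of (t, u) \<Rightarrow> exp (- x * t\<^sup>2) * exp (- b * u))"
        using assms has_bochner_integral_exp_neg[of b] by (auto simp: has_bochner_integral_iff)
      show "integrable half_line (\<lambda>t. LINT u|half_line. norm (case (t, u) of (t, u) \<Rightarrow> exp (- x * t\<^sup>2) * exp (- b * u)))"
        using assms integrable_exp_power[of x 2] by (simp add: abs_mult)
    qed measurable
    show "AE z in half_line \<Otimes>\<^sub>M half_line. norm (case_prod f z)
            \<le> norm (case z of (t, u) \<Rightarrow> exp (- x * t\<^sup>2) * exp (- b * u))"
      by (auto simp: f_def abs_mult mult_left_le)
  qed
  have "(LINT t|half_line. exp (- x * t\<^sup>2) * (b / (b\<^sup>2 + (t / 2)\<^sup>2))) = (LINT t|half_line. (LINT u|half_line. f t u))"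
    unfolding f_def by (simp only: integral_mult_right_zero laplace_cos(2)[OF assms(2)])
  also have "\<dots> = (LINT u|half_line. (LINT t|half_line. f t u))"
    by (rule HH.Fubini_integral[OF int, symmetric])
  also have "\<dots> = (LINT u|half_line. sqrt (pi / x) / 2 * (exp (- (1 / (16 * x)) * u\<^sup>2) * exp (- b * u)))"
  proof (rule integral_half_line_cong)
    fix u :: real
    have "(LINT t|half_line. f t u) = (LINT t|half_line. exp (- b * u) * (exp (- x * t\<^sup>2) * cos (u / 2 * t)))"
      by (simp add: f_def mult_ac)
    also have "\<dots> = exp (- b * u) * (sqrt (pi / x) / 2 * exp (- ((u / 2)\<^sup>2 / (4 * x))))"
      by (simp only: integral_mult_right_zero integral_gaussian_cos[OF assms(1)])
    finally show "(LINT t|half_line. f t u) = sqrt (pi / x) / 2 * (exp (- (1 / (16 * x)) * u\<^sup>2) * exp (- b * u))"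
      by (simp add: power_divide)
  qed
  finally show ?thesis by simp
qed

lemma integral_gaussian:
  fixes x :: real
  assumes "x > 0"
  shows "(LINT t|half_line. exp (- x * t\<^sup>2)) = sqrt (pi / x) / 2"
  using integral_gaussian_cos[OF assms, of 0] by simp

section \<open>Euler's constant as an integral over the half-line\<close>

lemma euler_kernel_bounds:
  fixes u :: real
  assumes "u > 0"
  shows "0 \<le> 1 / (1 - exp (- u)) - 1 / u" "1 / (1 - exp (- u)) - 1 / u \<le> 1"
proof -
  have pos: "1 - exp (- u) > 0" using assms by simp
  have "1 - exp (- u) \<le> u" using exp_ge_add_one_self[of "- u"] by linarith
  then show "0 \<le> 1 / (1 - exp (- u)) - 1 / u"
    using assms pos by (simp add: frac_le)
  have "(1 + u) * exp (- u) \<le> exp u * exp (- u)"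
    by (intro mult_right_mono exp_ge_add_one_self) simp
  then have "u \<le> (1 + u) * (1 - exp (- u))"
    by (simp add: exp_minus algebra_simps)
  then have "1 / (1 - exp (- u)) \<le> (1 + u) / u"
    using assms pos by (simp only: divide_le_eq le_divide_eq) (simp add: field_simps)
  then show "1 / (1 - exp (- u)) - 1 / u \<le> 1"
    using assms by (simp add: add_divide_distrib)
qed

text \<open>The factor 1 - exp(-nu) makes the first part of the integrand a finite geometric sum
  with integral \<open>harm n\<close>, and the second a Frullani integrand with integral log(n + 1).
  Dominated convergence then lets n tend to infinity.\<close>

lemma euler_mascheroni_integral:
  shows "integrable half_line (\<lambda>u. exp (- u) * (1 / (1 - exp (- u)) - 1 / u))"
    and "(LINT u|half_line. exp (- u) * (1 / (1 - exp (- u)) - 1 / u)) = euler_mascheroni"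
proof -
  define E :: "real \<Rightarrow> real" where "E u = exp (- u) * (1 / (1 - exp (- u)) - 1 / u)" for u
  have [measurable]: "E \<in> borel_measurable borel" unfolding E_def by measurable
  show int: "integrable half_line (\<lambda>u. exp (- u) * (1 / (1 - exp (- u)) - 1 / u))"
    by (rule integrable_half_line_bound[OF integrable_exp_power[of 1 1]])
       (use euler_kernel_bounds in \<open>auto simp: abs_mult mult_left_le\<close>)
  have "(\<lambda>n. LINT u|half_line. E u * (1 - exp (- real n * u))) \<longlonglongrightarrow> (LINT u|half_line. E u)"
  proof (rule half_line_dominated_convergence)
    show "integrable half_line (\<lambda>u. \<bar>E u\<bar>)" using int unfolding E_def by (rule integrable_abs)
    fix u :: real assume u: "u > 0"
    then have "(\<lambda>n. exp (- real n * u)) \<longlonglongrightarrow> 0" by real_asymp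
    then have "(\<lambda>n. E u * (1 - exp (- real n * u))) \<longlonglongrightarrow> E u * (1 - 0)" by (intro tendsto_intros)
    then show "(\<lambda>n. E u * (1 - exp (- real n * u))) \<longlonglongrightarrow> E u" by simp
    show "\<bar>E u * (1 - exp (- real n * u))\<bar> \<le> \<bar>E u\<bar>" for n
      using u by (simp add: abs_mult mult_left_le)
  qed measurable
  moreover have "(LINT u|half_line. E u * (1 - exp (- real n * u))) = harm n - ln (real n + 1)" for n
  proof -
    have "(LINT u|half_line. E u * (1 - exp (- real n * u))) = 
       (LINT u|half_line. (\<Sum>k<n. exp (- (real k + 1) * u)) - (exp (- 1 * u ^ 1) - exp (- (real n + 1) * u ^ 1)) / u)"
    proof (rule integral_half_line_cong)
      fix u :: real assume u: "u > 0"
      have "(\<Sum>k<n. exp (- (real k + 1) * u)) = exp (- u) * (\<Sum>k<n. exp (- u) ^ k)"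
        unfolding sum_distrib_left by (intro sum.cong) (auto simp: exp_of_nat_mult[symmetric] exp_add[symmetric] algebra_simps)
      also have "(\<Sum>k<n. exp (- u) ^ k) = (1 - exp (- real n * u)) / (1 - exp (- u))"
        using u by (subst sum_gp_strict) (auto simp: exp_of_nat_mult[symmetric])
      finally show "E u * (1 - exp (- real n * u)) = (\<Sum>k<n. exp (- (real k + 1) * u)) - (exp (- 1 * u ^ 1) - exp (- (real n + 1) * u ^ 1)) / u"
        by (simp add: E_def algebra_simps diff_divide_distrib exp_add exp_diff exp_minus divide_inverse)
    qed
    also have "\<dots> = (\<Sum>k<n. 1 / (real k + 1)) - ln (real n + 1)"
    proof -
      have "has_bochner_integral half_line (\<lambda>u. \<Sum>k<n. exp (- (real k + 1) * u)) (\<Sum>k<n. 1 / (real k + 1))"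
        by (intro has_bochner_integral_sum has_bochner_integral_exp_neg) simp
      moreover have "has_bochner_integral half_line
          (\<lambda>u. (exp (- 1 * u ^ 1) - exp (- (real n + 1) * u ^ 1)) / u) (ln (real n + 1))"
        using integrable_exp_power_frullani[of 1 1 "real n + 1" 1]
          integral_exp_power_frullani[of 1 1 "real n + 1" 1]
        unfolding has_bochner_integral_iff by auto
      ultimately show ?thesis
        by (intro has_bochner_integral_integral_eq has_bochner_integral_diff)
    qed
    also have "(\<Sum>k<n. 1 / (real k + 1)) = harm n"
      unfolding harm_def by (rule sum.reindex_bij_witness[of _ "\<lambda>k. k - 1" Suc]) (auto simp: field_simps)
    finally show ?thesis .
  qed
  moreover have "(\<lambda>n. harm n - ln (real n + 1)) \<longlonglongrightarrow> euler_mascheroni"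
  proof -
    \<comment> \<open>\<open>euler_mascheroni_LIMSEQ\<close> is stated with log n; the shift to
      log(n + 1) is a null sequence.\<close>
    have "(\<lambda>n. ln (real n + 1) - ln (real n)) \<longlonglongrightarrow> 0" by real_asymp
    from tendsto_diff[OF euler_mascheroni_LIMSEQ this] show ?thesis by simp
  qed
  ultimately have "(LINT u|half_line. E u) = euler_mascheroni"
    by (simp add: LIMSEQ_unique)
  then show "(LINT u|half_line. exp (- u) * (1 / (1 - exp (- u)) - 1 / u)) = euler_mascheroni"
    by (simp add: E_def)
qed

subsection \<open>Integral representation and asymptotic expansion\<close>

text \<open>The k-th term of the series for Re Digamma(1/4 + it/2) plus Euler's constant. Neither
  half is summable alone; the difference is O(1/k^2) for fixed t.\<close>

definition lorentzian_diff :: "nat \<Rightarrow> real \<Rightarrow> real" where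
  "lorentzian_diff k t = 1 / (real k + 1) - (real k + 1/4) / ((real k + 1/4)\<^sup>2 + (t / 2)\<^sup>2)"

lemma lorentzian_diff_measurable [measurable]: "lorentzian_diff k \<in> borel_measurable borel"
  unfolding lorentzian_diff_def[abs_def] by measurable

text \<open>Pass through 1/b with b = k + 1/4: the two steps give the constant and the quadratic
  part, both by way of k + 1 \<le> 4b. Since the bound separates k from t, summing over k yields one
  majorant for all partial sums.\<close>

lemma lorentzian_diff_bound: "\<bar>lorentzian_diff k t\<bar> \<le> (3 + 16 * t\<^sup>2) / (real k + 1)\<^sup>2"
proof -
  define m where "m = real k + 1"
  define b where "b = real k + 1/4"
  have m: "m \<ge> 1" and b: "b > 0" "m \<le> 4 * b" by (auto simp: m_def b_def)
  have "\<bar>1 / m - 1 / b\<bar> = (3/4) / (b * m)"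
    using m b by (simp add: m_def b_def field_simps)
  also have "\<dots> \<le> (3/4) / (m / 4 * m)"
    using m b by (intro divide_left_mono mult_right_mono) auto
  also have "\<dots> = 3 / m\<^sup>2" by (simp add: power2_eq_square)
  finally have A: "\<bar>1 / m - 1 / b\<bar> \<le> 3 / m\<^sup>2" .
  have pos: "b\<^sup>2 + (t / 2)\<^sup>2 > 0" using b by (intro add_pos_nonneg) auto
  have "1 / b - b / (b\<^sup>2 + (t / 2)\<^sup>2) = (t / 2)\<^sup>2 / (b * (b\<^sup>2 + (t / 2)\<^sup>2))"
    using b pos by (simp add: divide_simps) (simp add: power2_eq_square algebra_simps)
  also have "\<dots> \<le> (t / 2)\<^sup>2 / (m / 4 * (m / 4)\<^sup>2)"
    using m b pos by (intro divide_left_mono mult_mono add_increasing2 power_mono mult_pos_pos) auto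
  also have "\<dots> = 16 * t\<^sup>2 / m ^ 3"
    using m by (simp add: power2_eq_square power3_eq_cube)
  also have "\<dots> \<le> 16 * t\<^sup>2 / m\<^sup>2"
    using m by (intro divide_left_mono power_increasing) auto
  finally have "1 / b - b / (b\<^sup>2 + (t / 2)\<^sup>2) \<le> 16 * t\<^sup>2 / m\<^sup>2" .
  moreover have "0 \<le> 1 / b - b / (b\<^sup>2 + (t / 2)\<^sup>2)"
    using b pos by (simp add: divide_simps) (simp add: power2_eq_square)
  ultimately have "\<bar>1 / m - b / (b\<^sup>2 + (t / 2)\<^sup>2)\<bar> \<le> 3 / m\<^sup>2 + 16 * t\<^sup>2 / m\<^sup>2"
    using A by linarith
  then show ?thesis
    by (simp add: lorentzian_diff_def m_def b_def add_divide_distrib)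
qed

lemma integrable_gaussian_quadratic:
  fixes x :: real
  assumes "x > 0"
  shows "integrable half_line (\<lambda>t. exp (- x * t\<^sup>2) * (3 + 16 * t\<^sup>2))"
proof -
  have "integrable half_line (\<lambda>t. t powr (3 - 1) * exp (- x * t\<^sup>2))"
    using has_bochner_integral_powr_exp_power[of 3 x 2] assms by (auto simp: has_bochner_integral_iff)
  then have "integrable half_line (\<lambda>t. t\<^sup>2 * exp (- x * t\<^sup>2))"
    by (subst integrable_half_line_cong[where g = "\<lambda>t. t powr (3 - 1) * exp (- x * t\<^sup>2)"]) auto
  then have "integrable half_line (\<lambda>t. 3 * exp (- x * t\<^sup>2) + 16 * (t\<^sup>2 * exp (- x * t\<^sup>2)))"
    using integrable_exp_power[of x 2] assms by auto
  then show ?thesis by (simp add: algebra_simps)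
qed

lemma integrable_gaussian_lorentzian_diff:
  assumes "x > 0"
  shows "integrable half_line (\<lambda>t. exp (- x * t\<^sup>2) * lorentzian_diff k t)"
proof (rule integrable_half_line_bound[OF integrable_gaussian_quadratic[OF assms]])
  fix t :: real
  have "\<bar>lorentzian_diff k t\<bar> \<le> (3 + 16 * t\<^sup>2) / (real k + 1)\<^sup>2" by (rule lorentzian_diff_bound)
  also have "\<dots> \<le> (3 + 16 * t\<^sup>2) / 1"
    by (intro divide_left_mono) (auto simp: one_le_power)
  finally show "\<bar>exp (- x * t\<^sup>2) * lorentzian_diff k t\<bar> \<le> exp (- x * t\<^sup>2) * (3 + 16 * t\<^sup>2)"
    by (simp add: abs_mult)
qed measurable

lemma integrable_gaussian_exp:
  fixes x b :: real
  assumes "x > 0" "b > 0"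
  shows "integrable half_line (\<lambda>u. exp (- (1 / (16 * x)) * u\<^sup>2) * exp (- b * u))"
  by (rule integrable_half_line_bound[OF integrable_exp_power[of b 1]]) (use assms in \<open>auto simp: mult_left_le_one_le\<close>)

text \<open>Both halves carry the factor \<open>sqrt (pi / x) / 2\<close>. Writing
  \<open>1 / (real k + 1)\<close> as a Laplace integral puts them under one integral in u, whose
  integrand is geometric in k.\<close>

lemma integral_gaussian_lorentzian_diff:
  assumes "x > 0"
  shows "(LINT t|half_line. exp (- x * t\<^sup>2) * lorentzian_diff k t) = sqrt (pi / x) / 2 *
    (LINT u|half_line. exp (- (real k + 1) * u) - exp (- (1 / (16 * x)) * u\<^sup>2) * exp (- (real k + 1/4) * u))"
proof -
  define b where "b = real k + 1/4"
  have b: "b > 0" by (simp add: b_def)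
  have int1: "integrable half_line (\<lambda>t. exp (- x * t\<^sup>2) * (1 / (real k + 1)))"
    using integrable_exp_power[of x 2] assms by auto
  have "integrable half_line (\<lambda>t. exp (- x * t\<^sup>2) * (1 / (real k + 1)) - exp (- x * t\<^sup>2) * lorentzian_diff k t)"
    by (intro Bochner_Integration.integrable_diff int1 integrable_gaussian_lorentzian_diff assms)
  then have int2: "integrable half_line (\<lambda>t. exp (- x * t\<^sup>2) * (b / (b\<^sup>2 + (t / 2)\<^sup>2)))"
    by (simp add: lorentzian_diff_def b_def right_diff_distrib)
  have "(LINT t|half_line. exp (- x * t\<^sup>2) * lorentzian_diff k t) = 
     (LINT t|half_line. exp (- x * t\<^sup>2) * (1 / (real k + 1))) - (LINT t|half_line. exp (- x * t\<^sup>2) * (b / (b\<^sup>2 + (t / 2)\<^sup>2)))"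
    unfolding lorentzian_diff_def right_diff_distrib b_def[symmetric]
    by (rule Bochner_Integration.integral_diff[OF int1 int2])
  also have "(LINT t|half_line. exp (- x * t\<^sup>2) * (1 / (real k + 1))) = sqrt (pi / x) / 2 * (1 / (real k + 1))"
    by (simp only: integral_mult_left_zero integral_gaussian[OF assms])
  also have "1 / (real k + 1) = (LINT u|half_line. exp (- (real k + 1) * u))"
    using has_bochner_integral_exp_neg[of "real k + 1"] unfolding has_bochner_integral_iff by simp
  also have "(LINT t|half_line. exp (- x * t\<^sup>2) * (b / (b\<^sup>2 + (t / 2)\<^sup>2))) =
      sqrt (pi / x) / 2 * (LINT u|half_line. exp (- (1 / (16 * x)) * u\<^sup>2) * exp (- b * u))"
    by (rule integral_gaussian_lorentzian[OF assms b])
  finally have "(LINT t|half_line. exp (- x * t\<^sup>2) * lorentzian_diff k t) =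
      sqrt (pi / x) / 2 * ((LINT u|half_line. exp (- (real k + 1) * u)) 
        - (LINT u|half_line. exp (- (1 / (16 * x)) * u\<^sup>2) * exp (- b * u)))"
    by (simp only: right_diff_distrib)
  also have "(LINT u|half_line. exp (- (real k + 1) * u)) - (LINT u|half_line. exp (- (1 / (16 * x)) * u\<^sup>2) * exp (- b * u))
     = (LINT u|half_line. exp (- (real k + 1) * u) - exp (- (1 / (16 * x)) * u\<^sup>2) * exp (- b * u))"
    using has_bochner_integral_exp_neg[of "real k + 1"]
    by (intro Bochner_Integration.integral_diff[symmetric] integrable_gaussian_exp assms b) 
       (auto simp: has_bochner_integral_iff)
  finally show ?thesis by (simp only: b_def)
qed

lemma bernoulli_kernel_measurable [measurable]: "bernoulli_kernel \<in> borel_measurable borel"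
  unfolding bernoulli_kernel_def[abs_def] by measurable

lemma integrable_gaussian_bernoulli_kernel:
  fixes c :: real
  assumes "c > 0"
  shows "integrable half_line (\<lambda>u. exp (- c * u\<^sup>2) * bernoulli_kernel u)"
proof -
  obtain C where C: "C \<ge> 0" "\<And>u. u > 0 \<Longrightarrow> \<bar>bernoulli_kernel u\<bar> \<le> C"
    using bernoulli_kernel_remainder[of 0] by auto
  show ?thesis
  proof (rule integrable_half_line_bound)
    show "integrable half_line (\<lambda>u. exp (- c * u\<^sup>2) * C)"
      using integrable_exp_power[of c 2] assms by auto
    show "\<bar>exp (- c * u\<^sup>2) * bernoulli_kernel u\<bar> \<le> exp (- c * u\<^sup>2) * C" if "u > 0" for u
      using C(2)[OF that] by (simp add: abs_mult)
  qed measurable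
qed

text \<open>Expanding by exp(-u) produces the denominator that arises from summing the geometric
  series.\<close>

lemma bernoulli_kernel_eq:
  assumes "u > 0"
  shows "bernoulli_kernel u = 1 / u - exp (- u / 4) / (1 - exp (- u))"
proof -
  have "exp (3/4 * u) / (exp u - 1) = (exp (3/4 * u) * exp (- u)) / ((exp u - 1) * exp (- u))"
    by simp
  also have "exp (3/4 * u) * exp (- u) = exp (- u / 4)"
    by (simp add: exp_add[symmetric])
  also have "(exp u - 1) * exp (- u) = 1 - exp (- u)"
    by (simp add: algebra_simps exp_add[symmetric])
  finally show ?thesis by (simp add: bernoulli_kernel_def)
qed

text \<open>Adding and subtracting the Gaussian over u and exp(-u)/u splits \<open>K\<close> into
  the weighted Bernoulli kernel, the integrand for Euler's constant \<gamma>, and a Frullani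
  integrand with powers 1 and 2. The constants add up to \<gamma> + ((\<gamma> + log c)/2 -
  \<gamma>).\<close>

lemma Digamma_gaussian_kernel:
  fixes c :: real
  assumes "c > 0"
  defines "K \<equiv> \<lambda>u. (exp (- u) - exp (- c * u\<^sup>2) * exp (- u / 4)) / (1 - exp (- u))"
  shows "integrable half_line K"
    and "integral\<^sup>L half_line K =
      (LINT u|half_line. exp (- c * u\<^sup>2) * bernoulli_kernel u) + (euler_mascheroni + ln c) / 2"
proof -
  define L where "L u = (exp (- c * u\<^sup>2) * bernoulli_kernel u + exp (- u) * (1 / (1 - exp (- u)) - 1 / u))
      + (exp (- 1 * u ^ 1) - exp (- c * u\<^sup>2)) / u" for u :: real
  have eq: "K u = L u" if "u > 0" for u
    by (simp add: K_def L_def bernoulli_kernel_eq[OF that] diff_divide_distrib right_diff_distrib)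
  note ints = integrable_gaussian_bernoulli_kernel[OF assms(1)] euler_mascheroni_integral(1)
    integrable_exp_power_frullani[of 1 1 c 2]
  have "integrable half_line L"
    unfolding L_def using assms by (intro Bochner_Integration.integrable_add ints) auto
  then show "integrable half_line K"
    using eq by (subst integrable_half_line_cong[where g = L]) auto
  have "integral\<^sup>L half_line K = integral\<^sup>L half_line L"
    using eq by (rule integral_half_line_cong)
  also have "\<dots> = (LINT u|half_line. exp (- c * u\<^sup>2) * bernoulli_kernel u) + euler_mascheroni
       + (LINT u|half_line. (exp (- 1 * u ^ 1) - exp (- c * u\<^sup>2)) / u)"
    unfolding L_def using ints assms(1)
    by (subst Bochner_Integration.integral_add, force, force)
       (subst Bochner_Integration.integral_add, force, force, simp add: euler_mascheroni_integral(2))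
  also have "(LINT u|half_line. (exp (- 1 * u ^ 1) - exp (- c * u\<^sup>2)) / u) = (euler_mascheroni + ln c) / 2 - euler_mascheroni"
    using integral_exp_power_frullani[of 1 1 c 2] assms(1) by simp
  finally show "integral\<^sup>L half_line K =
      (LINT u|half_line. exp (- c * u\<^sup>2) * bernoulli_kernel u) + (euler_mascheroni + ln c) / 2"
    by linarith
qed

text \<open>Integrate the partial sums of the Digamma series against the Gaussian. In the variable u
  they become geometric sums, namely \<open>K u\<close> times 1 - exp(-nu); dominated convergence on
  both sides identifies the limits.\<close>

lemma integral_gaussian_Digamma:
  fixes x :: real
  assumes x: "x > 0"
  defines "D \<equiv> \<lambda>t. Re (Digamma (1/4 + \<i> * of_real t / 2)) + euler_mascheroni"
  defines "c \<equiv> 1 / (16 * x)"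
  shows "integrable half_line (\<lambda>t. exp (- x * t\<^sup>2) * D t)"
    and "(LINT t|half_line. exp (- x * t\<^sup>2) * D t) = sqrt (pi / x) / 2 *
           ((LINT u|half_line. exp (- c * u\<^sup>2) * bernoulli_kernel u) + (euler_mascheroni + ln c) / 2)"
proof -
  have c: "c > 0" using x by (simp add: c_def)
  have D: "(\<lambda>k. lorentzian_diff k t) sums D t" for t
    unfolding lorentzian_diff_def D_def by (rule Re_Digamma_quarter_sums)
  have "D = (\<lambda>t. \<Sum>k. lorentzian_diff k t)"
    using D by (auto simp: sums_iff)
  then have [measurable]: "D \<in> borel_measurable borel" by simp
  define S where "S = (\<Sum>k. 1 / (real k + 1)\<^sup>2)"
  have summ: "summable (\<lambda>k. 1 / (real k + 1)\<^sup>2)"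
    using inverse_power_summable[of 2, where ?'a = real] summable_Suc_iff[of "\<lambda>k. inverse ((real k)\<^sup>2)"]
    by (simp add: inverse_eq_divide add.commute)
  define w where "w t = S * (exp (- x * t\<^sup>2) * (3 + 16 * t\<^sup>2))" for t
  define s where "s n t = exp (- x * t\<^sup>2) * (\<Sum>k<n. lorentzian_diff k t)" for n :: nat and t
  have w: "integrable half_line w"
    unfolding w_def by (intro integrable_mult_right integrable_gaussian_quadratic x)
  have lim: "(\<lambda>n. s n t) \<longlonglongrightarrow> exp (- x * t\<^sup>2) * D t" for t
    unfolding s_def using D[of t] by (intro tendsto_intros) (simp add: sums_def)
  have bound: "\<bar>s n t\<bar> \<le> w t" for n t
  proof -
    have "\<bar>\<Sum>k<n. lorentzian_diff k t\<bar> \<le> (\<Sum>k<n. (3 + 16 * t\<^sup>2) * (1 / (real k + 1)\<^sup>2))"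
      using lorentzian_diff_bound by (intro order_trans[OF sum_abs] sum_mono) auto
    also have "\<dots> = (3 + 16 * t\<^sup>2) * (\<Sum>k<n. 1 / (real k + 1)\<^sup>2)"
      by (simp only: sum_distrib_left)
    also have "\<dots> \<le> (3 + 16 * t\<^sup>2) * S"
      unfolding S_def by (intro mult_left_mono sum_le_suminf summ) auto
    finally show ?thesis by (simp add: s_def w_def abs_mult mult_ac)
  qed
  have [measurable]: "s n \<in> borel_measurable borel" for n unfolding s_def by measurable
  \<comment> \<open>The limit inherits the uniform bound on the partial sums, which makes it
    integrable.\<close>
  have "\<bar>exp (- x * t\<^sup>2) * D t\<bar> \<le> w t" for t
    using bound by (intro LIMSEQ_le_const2[OF tendsto_rabs[OF lim[of t]]]) auto
  then show "integrable half_line (\<lambda>t. exp (- x * t\<^sup>2) * D t)"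
    by (intro integrable_half_line_bound[OF w]) auto
  have lhs: "(\<lambda>n. integral\<^sup>L half_line (s n)) \<longlonglongrightarrow> (LINT t|half_line. exp (- x * t\<^sup>2) * D t)"
    by (rule half_line_dominated_convergence[OF _ _ w lim bound]) measurable
  define K where "K u = (exp (- u) - exp (- c * u\<^sup>2) * exp (- u / 4)) / (1 - exp (- u))" for u
  have [measurable]: "K \<in> borel_measurable borel" unfolding K_def by measurable
  note K = Digamma_gaussian_kernel[OF c, folded K_def]
  have "integral\<^sup>L half_line (s n) = sqrt (pi / x) / 2 * (LINT u|half_line. K u * (1 - exp (- real n * u)))" for n
  proof -
    define h where "h k u = exp (- (real k + 1) * u) - exp (- c * u\<^sup>2) * exp (- (real k + 1/4) * u)" for k :: nat and u
    have h: "integrable half_line (h k)" for k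
      unfolding h_def c_def using has_bochner_integral_exp_neg[of "real k + 1"]
      by (intro Bochner_Integration.integrable_diff integrable_gaussian_exp x) (auto simp: has_bochner_integral_iff)
    have "integral\<^sup>L half_line (s n) = (\<Sum>k<n. LINT t|half_line. exp (- x * t\<^sup>2) * lorentzian_diff k t)"
      unfolding s_def sum_distrib_left
      by (rule Bochner_Integration.integral_sum) (rule integrable_gaussian_lorentzian_diff[OF x])
    also have "\<dots> = sqrt (pi / x) / 2 * (\<Sum>k<n. integral\<^sup>L half_line (h k))"
      unfolding integral_gaussian_lorentzian_diff[OF x] h_def c_def sum_distrib_left ..
    also have "(\<Sum>k<n. integral\<^sup>L half_line (h k)) = (LINT u|half_line. (\<Sum>k<n. h k u))"
      using h by (rule Bochner_Integration.integral_sum[symmetric])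
    also have "\<dots> = (LINT u|half_line. K u * (1 - exp (- real n * u)))"
    proof (rule integral_half_line_cong)
      fix u :: real assume u: "u > 0"
      have "h k u = (exp (- u) - exp (- c * u\<^sup>2) * exp (- u / 4)) * exp (- u) ^ k" for k
      proof -
        have "exp (- (real k + 1) * u) = exp (- u) * exp (- u) ^ k"
             "exp (- (real k + 1/4) * u) = exp (- u / 4) * exp (- u) ^ k"
          by (simp_all add: exp_of_nat_mult[symmetric] exp_add[symmetric] algebra_simps)
        then show ?thesis unfolding h_def by (simp only: left_diff_distrib mult.assoc)
      qed
      then have "(\<Sum>k<n. h k u) = (exp (- u) - exp (- c * u\<^sup>2) * exp (- u / 4)) * (\<Sum>k<n. exp (- u) ^ k)"
        by (simp only: sum_distrib_left)
      also have "(\<Sum>k<n. exp (- u) ^ k) = (1 - exp (- real n * u)) / (1 - exp (- u))"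
        using u by (subst sum_gp_strict) (auto simp: exp_of_nat_mult[symmetric])
      finally show "(\<Sum>k<n. h k u) = K u * (1 - exp (- real n * u))" by (simp add: K_def)
    qed
    finally show ?thesis .
  qed
  moreover have "(\<lambda>n. LINT u|half_line. K u * (1 - exp (- real n * u))) \<longlonglongrightarrow> integral\<^sup>L half_line K"
  proof (rule half_line_dominated_convergence)
    show "integrable half_line (\<lambda>u. \<bar>K u\<bar>)" using K(1) by (rule integrable_abs)
    fix u :: real assume u: "u > 0"
    then have "(\<lambda>n. exp (- real n * u)) \<longlonglongrightarrow> 0" by real_asymp
    then have "(\<lambda>n. K u * (1 - exp (- real n * u))) \<longlonglongrightarrow> K u * (1 - 0)" by (intro tendsto_intros)
    then show "(\<lambda>n. K u * (1 - exp (- real n * u))) \<longlonglongrightarrow> K u" by simp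
    show "\<bar>K u * (1 - exp (- real n * u))\<bar> \<le> \<bar>K u\<bar>" for n
      using u by (simp add: abs_mult mult_left_le)
  qed measurable
  ultimately have "(\<lambda>n. integral\<^sup>L half_line (s n)) \<longlonglongrightarrow> sqrt (pi / x) / 2 * integral\<^sup>L half_line K"
    by (simp only:) (rule tendsto_mult_left)
  from LIMSEQ_unique[OF lhs this] K(2)
  show "(LINT t|half_line. exp (- x * t\<^sup>2) * D t) = sqrt (pi / x) / 2 *
           ((LINT u|half_line. exp (- c * u\<^sup>2) * bernoulli_kernel u) + (euler_mascheroni + ln c) / 2)"
    by simp
qed

text \<open>The equivalent integral form of \<open>Phi\<close>. With \<gamma> Euler's constant, the
  constants combine by log \<pi> + \<gamma> - (\<gamma> - log 16x)/2 = (\<gamma> + log 16\<pi>^2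
  x)/2.\<close>

lemma Phi_eq:
  assumes x: "x > 0"
  shows "Phi x = (euler_mascheroni + ln (16 * pi\<^sup>2 * x)) / (8 * sqrt (pi * x))
     - 1 / (4 * sqrt (pi * x)) * (LINT u|half_line. exp (- (1 / (16 * x)) * u\<^sup>2) * bernoulli_kernel u)"
proof -
  define D where "D t = Re (Digamma (1/4 + \<i> * of_real t / 2)) + euler_mascheroni" for t
  define J where "J = (LINT u|half_line. exp (- (1 / (16 * x)) * u\<^sup>2) * bernoulli_kernel u)"
  note Dint = integral_gaussian_Digamma[OF x, folded D_def J_def]
  have "(LBINT t:{0..}. exp (- x * t\<^sup>2) * Psi t) = 
    (LINT t|half_line. exp (- x * t\<^sup>2) * (ln pi + euler_mascheroni) - exp (- x * t\<^sup>2) * D t)"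
    unfolding integral_nonneg_eq_half_line Psi_eq_Digamma D_def by (simp add: algebra_simps)
  also have "\<dots> = sqrt (pi / x) / 2 * (ln pi + euler_mascheroni)
      - sqrt (pi / x) / 2 * (J + (euler_mascheroni + ln (1 / (16 * x))) / 2)"
    using integrable_mult_left[OF integrable_exp_power[of x 2]] x Dint(1)
    by (subst Bochner_Integration.integral_diff) (auto simp only: integral_mult_left_zero integral_gaussian Dint(2))
  also have "\<dots> = sqrt (pi / x) / 2 * ((euler_mascheroni + ln (16 * pi\<^sup>2 * x)) / 2 - J)"
  proof -
    have "ln (16 * pi\<^sup>2 * x) = ln 16 + 2 * ln pi + ln x"
      using x by (simp add: ln_mult ln_realpow)
    moreover have "ln (1 / (16 * x)) = - ln 16 - ln x"
      using x by (simp add: ln_div ln_mult)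
    ultimately have "ln pi + euler_mascheroni - (J + (euler_mascheroni + ln (1 / (16 * x))) / 2) =
        (euler_mascheroni + ln (16 * pi\<^sup>2 * x)) / 2 - J"
      by (simp only:) (simp add: field_simps)
    then show ?thesis by (simp only: right_diff_distrib[symmetric])
  qed
  also have "sqrt (pi / x) = pi / sqrt (pi * x)"
    using x by (simp add: real_sqrt_divide real_sqrt_mult field_simps)
  finally have "Phi x = 1 / (2 * pi) * (pi / sqrt (pi * x) / 2 * ((euler_mascheroni + ln (16 * pi\<^sup>2 * x)) / 2 - J))"
    by (simp only: Phi_def)
  also have "\<dots> = (euler_mascheroni + ln (16 * pi\<^sup>2 * x)) / (8 * sqrt (pi * x)) - 1 / (4 * sqrt (pi * x)) * J"
    by (simp add: diff_divide_distrib right_diff_distrib)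
  finally show ?thesis by (simp only: J_def)
qed

section \<open>Gaussian moments and termwise integration\<close>

lemma has_bochner_integral_gaussian_power:
  fixes x :: real
  assumes "x > 0"
  shows "has_bochner_integral half_line (\<lambda>u. exp (- (1 / (16 * x)) * u\<^sup>2) * u ^ m)
           (4 ^ Suc m * x powr (real (Suc m) / 2) * Gamma (real (Suc m) / 2) / 2)"
proof -
  define c where "c = 1 / (16 * x)"
  have two: "2 * (real (Suc m) / 2) = real (Suc m)" by simp
  \<comment> \<open>The number 16 in the Gaussian is the source of the powers of 4, which become the
    factors \<open>2 ^ (2 * n)\<close> with \<open>n = Suc m\<close>.\<close>
  have "c powr (- (real (Suc m) / 2)) = (16 * x) powr (real (Suc m) / 2)"
    using assms by (simp add: c_def powr_minus powr_divide)
  also have "\<dots> = (4 powr 2) powr (real (Suc m) / 2) * x powr (real (Suc m) / 2)"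
    using assms by (simp add: powr_mult)
  also have "(4 powr 2) powr (real (Suc m) / 2) = 4 powr real (Suc m)"
    by (simp only: powr_powr two)
  also have "\<dots> = 4 ^ Suc m" by (rule powr_realpow) simp
  finally have "has_bochner_integral half_line (\<lambda>u. u powr (real (Suc m) - 1) * exp (- c * u\<^sup>2))
     (4 ^ Suc m * x powr (real (Suc m) / 2) * Gamma (real (Suc m) / 2) / 2)"
    using has_bochner_integral_powr_exp_power[of "real (Suc m)" c 2] assms by (simp add: c_def)
  also have "?this \<longleftrightarrow> ?thesis"
    by (rule has_bochner_integral_cong) (auto simp: space_restrict_space powr_realpow c_def)
  finally show ?thesis .
qed

text \<open>Integrate the global remainder bound against the Gaussian. The sum enters with a plus
  sign because the kernel behaves like minus the Bernoulli sum; the estimate holds for all positive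
  x.\<close>

lemma bernoulli_kernel_asymptotics:
  "\<exists>C. \<forall>x>0.
    \<bar>(LINT u|half_line. exp (- (1 / (16 * x)) * u\<^sup>2) * bernoulli_kernel u)
      + 1/2 * (\<Sum>n=1..N. 2 ^ (2 * n) * bernoulli_poly n (3/4) / fact n * Gamma (real n / 2) * x powr (real n / 2))\<bar>
    \<le> C * x powr (real (Suc N) / 2)"
proof -
  obtain C where C: "C \<ge> 0" "\<And>u. u > 0 \<Longrightarrow> 
     \<bar>bernoulli_kernel u + (\<Sum>n=1..N. bernoulli_poly n (3/4) / fact n * u ^ (n - 1))\<bar> \<le> C * u ^ N"
    using bernoulli_kernel_remainder by blast
  define b where "b n = bernoulli_poly n (3/4) / fact n" for n
  show ?thesis
  \<comment> \<open>\<open>C\<close> times the x-free factor of the N-th Gaussian moment, which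
    integrates the bound \<open>C * u ^ N\<close>.\<close>
  proof (intro exI[of _ "C * (4 ^ Suc N * Gamma (real (Suc N) / 2) / 2)"] allI impI)
    fix x :: real assume x: "x > 0"
    define e where "e u = exp (- (1 / (16 * x)) * u\<^sup>2)" for u
    define I where "I m = 4 ^ Suc m * x powr (real (Suc m) / 2) * Gamma (real (Suc m) / 2) / 2" for m
    have I: "has_bochner_integral half_line (\<lambda>u. e u * u ^ m) (I m)" for m
      unfolding I_def e_def by (rule has_bochner_integral_gaussian_power[OF x])
    have "has_bochner_integral half_line (\<lambda>u. \<Sum>n=1..N. b n * (e u * u ^ (n - 1))) (\<Sum>n=1..N. b n * I (n - 1))"
      by (intro has_bochner_integral_sum has_bochner_integral_mult_right I)
    moreover have "has_bochner_integral half_line (\<lambda>u. e u * bernoulli_kernel u) (LINT u|half_line. e u * bernoulli_kernel u)"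
      using integrable_gaussian_bernoulli_kernel[of "1 / (16 * x)"] x
      by (simp add: has_bochner_integral_iff e_def)
    ultimately have sum: "has_bochner_integral half_line
        (\<lambda>u. e u * bernoulli_kernel u + (\<Sum>n=1..N. b n * (e u * u ^ (n - 1))))
        ((LINT u|half_line. e u * bernoulli_kernel u) + (\<Sum>n=1..N. b n * I (n - 1)))"
      by (rule has_bochner_integral_add[rotated])
    have le: "norm (e u * bernoulli_kernel u + (\<Sum>n=1..N. b n * (e u * u ^ (n - 1)))) \<le> C * (e u * u ^ N)" 
      if "u > 0" for u
    proof -
      have "e u * bernoulli_kernel u + (\<Sum>n=1..N. b n * (e u * u ^ (n - 1))) = 
            e u * (bernoulli_kernel u + (\<Sum>n=1..N. b n * u ^ (n - 1)))"
        by (simp add: distrib_left sum_distrib_left mult_ac)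
      then have "norm (e u * bernoulli_kernel u + (\<Sum>n=1..N. b n * (e u * u ^ (n - 1)))) =
          e u * \<bar>bernoulli_kernel u + (\<Sum>n=1..N. b n * u ^ (n - 1))\<bar>"
        by (simp add: abs_mult e_def)
      also have "\<dots> \<le> e u * (C * u ^ N)"
        using C(2)[OF that] by (intro mult_left_mono) (auto simp: b_def e_def)
      finally show ?thesis by (simp add: mult_ac)
    qed
    have "norm (LINT u|half_line. e u * bernoulli_kernel u + (\<Sum>n=1..N. b n * (e u * u ^ (n - 1)))) \<le>
          (LINT u|half_line. C * (e u * u ^ N))"
    proof (rule Bochner_Integration.integral_norm_bound_integral)
      show "integrable half_line (\<lambda>u. e u * bernoulli_kernel u + (\<Sum>n=1..N. b n * (e u * u ^ (n - 1))))"
        using sum by (simp add: has_bochner_integral_iff)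
      show "integrable half_line (\<lambda>u. C * (e u * u ^ N))"
        using I[of N] by (simp add: has_bochner_integral_iff)
    qed (use le in \<open>simp add: space_restrict_space\<close>)
    also note has_bochner_integral_integral_eq[OF sum]
    also have "\<dots> = C * I N"
      using I[of N] by (simp add: has_bochner_integral_iff)
    also have "(\<Sum>n=1..N. b n * I (n - 1)) = 
       1/2 * (\<Sum>n=1..N. 2 ^ (2 * n) * bernoulli_poly n (3/4) / fact n * Gamma (real n / 2) * x powr (real n / 2))"
      unfolding sum_distrib_left
    proof (rule sum.cong)
      fix n assume "n \<in> {1..N}"
      then have n: "Suc (n - 1) = n" by simp
      have four: "2 ^ (2 * n) = (4 :: real) ^ n" by (simp add: power_mult)
      show "b n * I (n - 1) = 1/2 * (2 ^ (2 * n) * bernoulli_poly n (3/4) / fact n * Gamma (real n / 2) * x powr (real n / 2))"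
        unfolding I_def n four by (simp add: b_def mult_ac)
    qed simp
    finally show "\<bar>(LINT u|half_line. exp (- (1 / (16 * x)) * u\<^sup>2) * bernoulli_kernel u)
      + 1/2 * (\<Sum>n=1..N. 2 ^ (2 * n) * bernoulli_poly n (3/4) / fact n * Gamma (real n / 2) * x powr (real n / 2))\<bar>
    \<le> C * (4 ^ Suc N * Gamma (real (Suc N) / 2) / 2) * x powr (real (Suc N) / 2)"
      by (simp add: I_def e_def mult_ac)
  qed
qed

theorem theorem3p7:
  fixes N :: nat
  assumes "N \<ge> 1"
  shows "(\<lambda>x::real. Phi x
            - ((euler_mascheroni + ln (16 * pi\<^sup>2 * x)) / (8 * sqrt (pi * x))
               + 1 / (8 * sqrt pi) * (\<Sum>n = 1..N. 2 ^ (2 * n) * bernoulli_poly n (3/4) / fact n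
                   * Gamma (real n / 2) * x powr ((real n - 1) / 2))))
         \<in> O[at_right 0](\<lambda>x. x powr (real N / 2))"
proof -
  define a where "a n = 2 ^ (2 * n) * bernoulli_poly n (3/4) / fact n * Gamma (real n / 2)" for n
  define J where "J x = (LINT u|half_line. exp (- (1 / (16 * x)) * u\<^sup>2) * bernoulli_kernel u)" for x
  obtain C where C: "\<And>x. x > 0 \<Longrightarrow> 
     \<bar>J x + 1/2 * (\<Sum>n=1..N. a n * x powr (real n / 2))\<bar> \<le> C * x powr (real (Suc N) / 2)"
    using bernoulli_kernel_asymptotics[of N] unfolding J_def a_def by blast
  define R where "R x = Phi x - ((euler_mascheroni + ln (16 * pi\<^sup>2 * x)) / (8 * sqrt (pi * x))
               + 1 / (8 * sqrt pi) * (\<Sum>n = 1..N. a n * x powr ((real n - 1) / 2)))" for x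
  have "\<bar>R x\<bar> \<le> C / (4 * sqrt pi) * x powr (real N / 2)" if x: "x > 0" for x
  proof -
    have "sqrt x = x powr (1/2)" using x by (simp add: powr_half_sqrt)
    \<comment> \<open>Dividing by \<open>sqrt (pi * x)\<close> lowers every exponent by one half:
      n/2 becomes (n - 1)/2 in the sum and (N + 1)/2 becomes N/2 in the error.\<close>
    then have shift: "x powr (r / 2) = sqrt x * x powr ((r - 1) / 2)" for r
      by (simp add: powr_add[symmetric] diff_divide_distrib)
    have sum: "(\<Sum>n=1..N. a n * x powr (real n / 2)) = sqrt x * (\<Sum>n=1..N. a n * x powr ((real n - 1) / 2))"
      unfolding sum_distrib_left by (intro sum.cong refl) (subst shift, simp)
    \<comment> \<open>The logarithmic terms cancel exactly, and 1/4 times 1/2 gives the prefactor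
      1/8 of the sum.\<close>
    have "R x = - (J x + 1/2 * (\<Sum>n=1..N. a n * x powr (real n / 2))) / (4 * sqrt (pi * x))"
      unfolding R_def Phi_eq[OF x] J_def[symmetric] sum using x
      by (simp add: real_sqrt_mult add_divide_distrib diff_divide_distrib)
    then have "\<bar>R x\<bar> = \<bar>J x + 1/2 * (\<Sum>n=1..N. a n * x powr (real n / 2))\<bar> / (4 * sqrt (pi * x))"
      using x by (simp add: abs_divide)
    also have "\<dots> \<le> C * x powr (real (Suc N) / 2) / (4 * sqrt (pi * x))"
      using x by (intro divide_right_mono C) auto
    also have "\<dots> = C / (4 * sqrt pi) * x powr (real N / 2)"
      using x by (subst shift) (simp add: real_sqrt_mult)
    finally show ?thesis .
  qed
  then have "R \<in> O[at_right 0](\<lambda>x. x powr (real N / 2))"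
    by (intro bigoI[where c = "C / (4 * sqrt pi)"] eventually_mono[OF eventually_at_right_less]) auto
  then show ?thesis by (simp add: R_def[abs_def] a_def)
qed

end
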